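(* Let $m$ and $k$ be positive integers with $k\ge 2$ such that $1^k+2^k+\cdots+(m-1)^k=m^k$. Suppose that every prime divisor $p>3$ of $m+2$ satisfies $p\equiv 5\pmod 8$ or $p\equiv 7\pmod 8$. Then $$m\ge \begin{cases}10^{10^{16}} & \text{if } 3\nmid m+2;\\ 10^{10^{11}} & \text{if } 3\mid m+2.\end{cases}$$
   Context: The sum $1^k+2^k+\cdots+(m-1)^k$ denotes $\sum_{j=1}^{m-1}j^k$. *)

theory Defs
  imports "HOL-Number_Theory.Number_Theory"
begin

end

theory Submission
  imports Defs "HOL-Analysis.Analysis" "HOL-Computational_Algebra.Squarefree"
begin

text \<open>
  Let \<open>N\<close> be one of \<open>m - 1\<close>, \<open>m + 1\<close>, \<open>2 m - 1\<close>, \<open>2 m + 1\<close> and let \<open>p\<close> be a prime factor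
  of \<open>N\<close>.  Modulo \<open>p\<close> the sum of the \<open>j ^ k\<close> over \<open>j < N\<close> splits into \<open>N / p\<close> full periods, so it is
  \<open>- N / p\<close> if \<open>p - 1\<close> divides \<open>k\<close> and \<open>0\<close> otherwise (\<open>power_sum_mod_prime\<close>).  The equation evaluates
  the same sum as \<open>c * m ^ k\<close> with \<open>c\<close> equal to \<open>1\<close>, \<open>2\<close>, \<open>2\<close>, \<open>4\<close>.  For \<open>p\<close> not dividing \<open>c\<close> this
  forces \<open>p - 1\<close> to divide \<open>k\<close> and \<open>p\<close> to divide \<open>N / p + c\<close> (\<open>power_sum_eq_nonzero_power\<close>).
  These are Moser's relations: the sum of \<open>1 / p\<close> over the primes dividing \<open>N\<close>, plus \<open>c / N\<close>, is a
  positive integer (\<open>weighted_sum_prime_factors\<close>); for \<open>m + 1 = 4 n\<close> with \<open>n\<close> odd one gets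
  \<open>1 / 2\<close> in place of \<open>1\<close> from \<open>n\<close> alone.

  For \<open>N = m + 2\<close> and \<open>p > 3\<close> the sum is \<open>2 m ^ k + (m + 1) ^ k\<close>, which is \<open>2 ^ (k + 1) + 1\<close> modulo \<open>p\<close>.  As \<open>k\<close>
  is even, it vanishes only if \<open>-2\<close> is a square modulo \<open>p\<close>, and this is what \<open>p \<equiv> 5, 7 (mod 8)\<close>
  excludes.  Hence \<open>p - 1\<close> divides \<open>k\<close> and there is a fifth relation, with \<open>c = 3\<close>.  Two of the five
  numbers can share only the odd primes \<open>3\<close> and \<open>5\<close>, so the primes dividing their product have reciprocal
  sum at least \<open>9/2 - 1/3 - 1/5 = 119/30\<close> up to \<open>O(1 / m)\<close>.  If \<open>3\<close> divides \<open>m + 2\<close>, two situations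
  arise.  If \<open>3\<close> divides \<open>k\<close>, then \<open>m + 2\<close> is \<open>9\<close> times a number that is \<open>2\<close> modulo \<open>3\<close>, and the fifth
  relation still contributes \<open>2/3\<close>.  Otherwise no prime that is \<open>1\<close> modulo \<open>3\<close> divides any of the first
  four numbers, and the first few of these primes (with \<open>5\<close>) can be adjoined to the set at hardly any cost.
  Either way one has a set of primes with reciprocal sum at least \<open>109/30\<close> up to \<open>O(1 / m)\<close>.

  The product of all these primes is at most about \<open>m ^ 5\<close>, so a lower bound for \<open>m\<close> follows from an
  explicit form of Mertens' theorem: a finite set \<open>P\<close> of primes with product at most \<open>exp X\<close> has
  reciprocal sum at most roughly \<open>ln (ln X) + 0.3\<close> (\<open>sum_recip_primes_le_two_power\<close>).  The true constant
  is \<open>0.2615\<dots>\<close>, and the difference is what allows an elementary proof.  It is a duality argument.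
  With \<open>b = ln y\<close>, write \<open>1 / p = (1 / p - ln p / (y b)) + ln p / (y b)\<close>.  The
  second terms sum to at most \<open>X / (y b)\<close>, and the first term is negative for \<open>p > y\<close>, so it suffices to
  bound the sum of \<open>\<Lambda>(n) / n * w(n)\<close> over \<open>n \<le> y\<close>, with \<open>w(n) = 1 / ln n - n / (y b)\<close>.  Write \<open>w(n)\<close> as
  \<open>(1 - n / y) / b\<close> plus \<open>1 / ln n - 1 / b\<close>.  The first part is bounded by \<open>ln (y!)\<close>, because
  \<open>y / n - 1\<close> is less than the integral part of \<open>y / n\<close>.  The second part is a convex function of \<open>ln n\<close>,
  hence a mixture of the functions \<open>max 0 (u - ln n)\<close> over \<open>u \<le> b\<close>.  The corresponding sums
  \<open>\<Lambda>(n) / n * ln (t / n)\<close> are much smoother than the partial sums of \<open>\<Lambda>(n) / n\<close>: comparing them term by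
  term with the sums of \<open>ln j / j\<close> and \<open>ln j\<close> gives \<open>(ln t)^2 / 2 - (19/33) ln t + O(1)\<close>, where
  \<open>19/33 = 0.5757\<dots>\<close> is an approximation to Euler's constant \<open>0.5772\<dots>\<close>.  Only the small \<open>n\<close> make this wasteful.
  Below \<open>1024\<close> the function \<open>1 / ln n\<close> is therefore replaced by its tangent line at \<open>ln 1024\<close>, and the
  difference, a sum over the primes up to \<open>1024\<close> with quadratically decaying weights, is computed.
  The proper prime powers up to \<open>1024\<close>, which the sum over \<open>\<Lambda>\<close> counts as well, are subtracted.
\<close>

section \<open>Sums over the von Mangoldt function\<close>

lemma ln_2_bounds: "ln 2 \<ge> (6931 / 10000::real)" "ln 2 \<le> (6932 / 10000::real)"
  using ln_approx_bounds[of 2 4] by (simp_all add: eval_nat_numeral)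

lemma ln_3_le: "ln 3 \<le> (10987 / 10000::real)"
  using ln_approx_bounds[of 3 6] by (simp_all add: eval_nat_numeral)

lemma ln_5_le: "ln 5 \<le> (16095 / 10000::real)"
  using ln_approx_bounds[of 5 10] by (simp_all add: eval_nat_numeral)

lemma ln_7_le: "ln 7 \<le> (1946 / 1000::real)"
  using ln_approx_bounds[of 7 14] by (simp_all add: eval_nat_numeral)

text \<open>
  Expand \<open>ln j\<close> as the sum of \<open>\<Lambda>\<close> over the divisors of \<open>j\<close> and exchange the two sums.
\<close>

lemma sum_mangoldt_dirichlet:
  fixes f :: "nat \<Rightarrow> real"
  shows "(\<Sum>j=1..N. f j * ln (real j)) = (\<Sum>n=1..N. mangoldt n * (\<Sum>i=1..N div n. f (i * n)))"
proof -
  have "(\<Sum>j=1..N. f j * ln (real j)) = (\<Sum>j=1..N. \<Sum>n | n dvd j. f j * mangoldt n)"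
    by (simp flip: sum_distrib_left add: mangoldt_sum)
  also have "\<dots> = (\<Sum>(j, n)\<in>(SIGMA j:{1..N}. {n. n dvd j}). f j * mangoldt n)"
    by (subst sum.Sigma) auto
  also have "\<dots> = (\<Sum>(n, i)\<in>(SIGMA n:{1..N}. {1..N div n}). mangoldt n * f (i * n))"
    by (rule sum.reindex_bij_witness[of _ "\<lambda>(n, i). (i * n, n)" "\<lambda>(j, n). (n, j div n)"])
       (force simp: less_eq_div_iff_mult_less_eq Suc_le_eq dvd_div_eq_0_iff div_le_mono
              dest: dvd_imp_le intro: dvd_pos_nat Nat.gr0I)+
  also have "\<dots> = (\<Sum>n=1..N. mangoldt n * (\<Sum>i=1..N div n. f (i * n)))"
    by (subst sum.Sigma [symmetric]) (auto simp: sum_distrib_left)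
  finally show ?thesis .
qed

lemma ln_fact_eq_sum_mangoldt:
  "ln (fact N) = (\<Sum>n=1..N. mangoldt n * real (N div n))"
proof -
  have "ln (fact N :: real) = (\<Sum>j=1..N. ln (real j))"
    by (induction N) (simp_all add: ln_mult del: of_nat_Suc)
  then show ?thesis using sum_mangoldt_dirichlet[of "\<lambda>_. 1" N] by simp
qed

lemma sum_ln_div_eq_sum_mangoldt:
  "(\<Sum>j=1..N. ln (real j) / real j) = (\<Sum>n=1..N. mangoldt n / real n * harm (N div n))"
  using sum_mangoldt_dirichlet[of "\<lambda>j. 1 / real j" N]
  by (simp add: harm_def sum_distrib_left field_simps)

text \<open>
  The left-hand side tends to Euler's constant from below, with an error of about \<open>1 / (2 j)\<close>; since
  the constant exceeds \<open>1 / 2\<close>, the factor \<open>j / (j + 1)\<close> makes up for that error.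
\<close>

lemma harm_minus_ln_ge:
  assumes "j > 0"
  shows "harm j - ln (real j + 1) \<ge> (19/33) * (real j / (real j + 1))"
proof (cases "j \<ge> 7")
  case True
  have "euler_mascheroni \<le> harm j - ln (real j + 1) + 1 / (2 * real j)"
    using euler_mascheroni_upper[of "j - 1"] assms by (simp add: of_nat_diff add.commute)
  moreover have "(19/33) * (real j / (real j + 1)) \<le> 19/33 - 1 / (2 * real j)"
    using True by (simp add: field_simps)
  ultimately show ?thesis using euler_mascheroni_gt_19_over_33 by linarith
next
  case False
  then have "j \<in> {1,2,3,4,5,6}" using assms by auto
  moreover have "ln (4::real) = 2 * ln 2" "ln (6::real) = ln 2 + ln 3"
    using ln_realpow[of 2 2] ln_mult[of 2 3] by auto
  ultimately show ?thesis
    using ln_2_bounds ln_3_le ln_5_le ln_7_le by (auto simp: harm_expand)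
qed

text \<open>
  On \<open>[j, j + 1)\<close> the function \<open>ln u + (19/33) j / u\<close> is increasing, so only its limit at
  \<open>j + 1\<close> matters.
\<close>

lemma ln_le_harm_floor:
  fixes u :: real and j :: nat
  assumes "j > 0" "real j \<le> u" "u < real j + 1"
  shows "ln u \<le> harm j - (19/33) * (real j / u)"
proof -
  have u: "u > 0" using assms by linarith
  have "ln u = ln (real j + 1) + ln (u / (real j + 1))"
    using u by (subst ln_div) auto
  also have "ln (u / (real j + 1)) \<le> u / (real j + 1) - 1"
    using u assms by (intro ln_le_minus_one) auto
  also have "u / (real j + 1) - 1 \<le> (19/33) * (real j / (real j + 1)) - (19/33) * (real j / u)"
  proof -
    have "(19/33) * (real j / u) - (19/33) * (real j / (real j + 1)) =
       ((19/33) * real j / u) * ((real j + 1 - u) / (real j + 1))"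
      using u by (simp add: divide_simps) (simp add: algebra_simps)
    also have "\<dots> \<le> 1 * ((real j + 1 - u) / (real j + 1))"
      using assms u by (intro mult_right_mono) (auto simp: field_simps)
    also have "\<dots> = 1 - u / (real j + 1)" by (simp add: field_simps)
    finally show ?thesis by linarith
  qed
  finally show ?thesis using harm_minus_ln_ge[OF assms(1)] by linarith
qed

text \<open>
  The sums of \<open>ln j / j\<close> and of \<open>ln j\<close> are sums over \<open>\<Lambda>(n) / n\<close> with weights \<open>harm j\<close> and
  \<open>n * j\<close>, where \<open>j\<close> is the integral part of \<open>t / n\<close>.  So the inequality holds term by term.
\<close>

lemma sum_mangoldt_ln_le:
  fixes t :: real
  assumes "t \<ge> 1"
  defines "N \<equiv> nat \<lfloor>t\<rfloor>"
  shows "(\<Sum>n=1..N. mangoldt n / real n * ln (t / real n))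
         \<le> (\<Sum>j=1..N. ln (real j) / real j) - (19/33) * ln (fact N) / t"
proof -
  have "(\<Sum>n=1..N. mangoldt n / real n * ln (t / real n)) \<le>
    (\<Sum>n=1..N. mangoldt n / real n * (harm (N div n) - (19/33) * (real (N div n) / (t / real n))))"
  proof (intro sum_mono mult_left_mono)
    fix n assume n: "n \<in> {1..N}"
    have "\<lfloor>t / real n\<rfloor> = \<lfloor>t\<rfloor> div int n"
      using floor_divide_real_eq_div[of "int n" t] by simp
    then have j: "N div n = nat \<lfloor>t / real n\<rfloor>"
      unfolding N_def using assms(1) by (simp add: nat_div_distrib)
    have "t / real n \<ge> 1" using n assms(1) unfolding N_def by (auto simp: le_nat_iff le_floor_iff field_simps)
    then have "N div n > 0" "real (N div n) \<le> t / real n" "t / real n < real (N div n) + 1"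
      unfolding j by (auto; linarith)+
    then show "ln (t / real n) \<le> harm (N div n) - (19/33) * (real (N div n) / (t / real n))"
      by (rule ln_le_harm_floor)
  qed (auto simp: mangoldt_nonneg)
  also have "\<dots> = (\<Sum>n=1..N. mangoldt n / real n * harm (N div n))
      - (\<Sum>n=1..N. (19/33) / t * (mangoldt n * real (N div n)))"
    unfolding sum_subtractf [symmetric]
    by (intro sum.cong) (auto simp: field_simps)
  also have "\<dots> = (\<Sum>j=1..N. ln (real j) / real j) - (19/33) * ln (fact N) / t"
    unfolding sum_ln_div_eq_sum_mangoldt ln_fact_eq_sum_mangoldt
    by (simp add: sum_distrib_left sum_divide_distrib)
  finally show ?thesis .
qed

lemma ln_fact_ge:
  fixes t :: real
  assumes "t \<ge> 1"
  shows "ln (fact (nat \<lfloor>t\<rfloor>)) \<ge> t * ln t - t - ln t"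
proof -
  define N where "N = nat \<lfloor>t\<rfloor>"
  have N: "N \<ge> 1" "real N \<le> t" "t < real N + 1"
    using assms unfolding N_def by (auto simp: le_nat_iff; linarith)+
  have fact_ge: "ln (fact n) \<ge> real n * ln (real n) - real n" if "n \<ge> 1" for n :: nat
    using that
  proof (induction n rule: dec_induct)
    case (step n)
    have "ln (real (Suc n) / real n) \<le> real (Suc n) / real n - 1"
      using step by (intro ln_le_minus_one) auto
    then have "real n * (ln (real (Suc n)) - ln (real n)) \<le> 1"
      using step by (subst (asm) ln_div) (auto simp: field_simps)
    moreover have "ln (fact (Suc n)::real) = ln (real (Suc n)) + ln (fact n)"
      by (simp add: ln_mult del: of_nat_Suc)
    ultimately show ?case using step by (simp add: algebra_simps)
  qed auto
  have "ln (t / real N) \<le> t / real N - 1"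
    using N by (intro ln_le_minus_one) auto
  then have "real N * (ln t - ln (real N)) \<le> t - real N"
    using N by (subst (asm) ln_div) (auto simp: field_simps)
  moreover have "(t - real N) * ln t \<le> 1 * ln t"
    using N assms by (intro mult_right_mono) auto
  ultimately have "real N * ln (real N) - real N \<ge> t * ln t - t - ln t"
    by (simp add: algebra_simps)
  then show ?thesis using fact_ge[OF N(1)] unfolding N_def by linarith
qed

lemma ln_fact_le:
  assumes "N \<ge> 1"
  shows "ln (fact N) \<le> real N * ln (real N) - real N + ln (real N) + 1"
  using assms
proof (induction N rule: dec_induct)
  case (step n)
  have "ln (real n / real (Suc n)) \<le> real n / real (Suc n) - 1"
    using step by (intro ln_le_minus_one) auto
  then have "real (Suc n) * (ln (real (Suc n)) - ln (real n)) \<ge> 1"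
    using step by (subst (asm) ln_div) (auto simp: field_simps)
  moreover have "ln (fact (Suc n)::real) = ln (real (Suc n)) + ln (fact n)"
    by (simp add: ln_mult del: of_nat_Suc)
  ultimately show ?case using step by (simp add: algebra_simps)
qed auto

text \<open>
  For \<open>j \<ge> 4\<close> the terms are at most the corresponding increments of \<open>(ln x)^2 / 2\<close>, because
  \<open>ln x / x\<close> decreases beyond \<open>exp 1\<close>.  The constant comes from the terms up to \<open>8\<close>.
\<close>

lemma sum_ln_div_le:
  assumes "N \<ge> 8"
  shows "(\<Sum>j=1..N. ln (real j) / real j) \<le> (ln (real N))\<^sup>2 / 2 + 6 / 100"
  using assms
proof (induction N rule: dec_induct)
  case base
  have l4: "ln (4::real) = 2 * ln 2" "ln (6::real) = ln 2 + ln 3" "ln (8::real) = 3 * ln 2"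
    using ln_realpow[of 2 2] ln_mult[of 2 3] ln_realpow[of 2 3] by auto
  have "(6931/10000)^2 \<le> ln (2::real)^2"
    using ln_2_bounds by (intro power_mono) auto
  then have "48038 / 100000 \<le> ln (2::real)^2" by (simp add: power2_eq_square)
  moreover have sum_eq: "(\<Sum>j=1..8. ln (real j) / real j) =
      11/8 * ln 2 + ln 3 / 3 + ln 5 / 5 + (ln 2 + ln 3) / 6 + ln 7 / 7"
    by (simp add: l4 eval_nat_numeral)
  moreover have sq_eq: "(ln (real 8))\<^sup>2 = 9 * (ln 2)\<^sup>2"
    by (simp add: l4 power_mult_distrib)
  ultimately show ?case
    using ln_2_bounds ln_3_le ln_5_le ln_7_le unfolding sum_eq sq_eq
    by (simp add: field_simps)
next
  case (step n)
  have "ln (real (Suc n)) / real (Suc n) \<le> ln (real (Suc n)) ^ 2 / 2 - ln (real n) ^ 2 / 2"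
  proof -
    have "\<exists>z>real n. z < real n + 1 \<and>
       (ln (real n + 1))^2/2 - (ln (real n))^2/2 = (real n + 1 - real n) * (ln z / z)"
      using step by (intro MVT2) (auto intro!: derivative_eq_intros simp: power2_eq_square)
    then obtain z where z: "z > real n" "z < real n + 1"
       "(ln (real n + 1))^2/2 - (ln (real n))^2/2 = ln z / z" by auto
    have "exp 1 \<le> z" using exp_le z step by linarith
    then have "ln (real n + 1) / (real n + 1) \<le> ln z / z"
      using z by (intro ln_x_over_x_mono) auto
    then show ?thesis using z by (simp add: add.commute)
  qed
  then show ?case using step by simp
qed

lemma sum_mangoldt_ln_le_quadratic:
  fixes t :: real
  assumes "t \<ge> 1024"
  shows "(\<Sum>n=1..nat \<lfloor>t\<rfloor>. mangoldt n / real n * ln (t / real n))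
         \<le> (ln t)\<^sup>2 / 2 - (19/33) * ln t + 64 / 100"
proof -
  define N where "N = nat \<lfloor>t\<rfloor>"
  have N: "N \<ge> 8" "real N \<le> t"
    using assms unfolding N_def by (auto simp: le_nat_iff; linarith)+
  have "ln t / t \<le> ln 1024 / (1024::real)"
    using assms exp_le by (intro ln_x_over_x_mono) auto
  also have "\<dots> \<le> 7 / 1000"
    using ln_realpow[of 2 10] ln_2_bounds by simp
  finally have "ln t / t \<le> 7 / 1000" .
  moreover have "ln (fact N) / t \<ge> (t * ln t - t - ln t) / t"
    using ln_fact_ge[of t] assms unfolding N_def by (intro divide_right_mono) auto
  moreover have "(t * ln t - t - ln t) / t = ln t - 1 - ln t / t"
    using assms by (simp add: field_simps)
  moreover have "(ln (real N))\<^sup>2 / 2 \<le> (ln t)\<^sup>2 / 2"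
    using N by (intro divide_right_mono power_mono) auto
  moreover have "(\<Sum>n=1..N. mangoldt n / real n * ln (t / real n))
      \<le> (\<Sum>j=1..N. ln (real j) / real j) - (19/33) * (ln (fact N) / t)"
    using sum_mangoldt_ln_le[of t] assms unfolding N_def by simp
  ultimately show ?thesis
    using sum_ln_div_le[OF N(1)] unfolding N_def by linarith
qed

section \<open>A weighted sum with smooth cutoff\<close>

text \<open>
  The convex function \<open>1 / s\<close>, continued to the left of \<open>c\<close> by its tangent line at \<open>c\<close>.
\<close>

definition tangent_recip :: "real \<Rightarrow> real \<Rightarrow> real" where
  "tangent_recip c s = (if s \<le> c then 2 / c - s / c\<^sup>2 else 1 / s)"

text \<open>
  Subtracting the tangent line at \<open>b\<close>, which is \<open>1 / b + (b - s) / b^2\<close>, leaves a convex function that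
  vanishes to second order at \<open>b\<close>.  Such a function is the integral of \<open>max 0 (u - s)\<close> against its own
  second derivative, here \<open>2 / u^3\<close> on \<open>[c, b]\<close>.
\<close>

lemma tangent_recip_integral:
  assumes "0 < c" "c \<le> b" "s \<le> b"
  shows "((\<lambda>u. max 0 (u - s) * (2 / u ^ 3)) has_integral
           (tangent_recip c s - 1 / b - (b - s) / b\<^sup>2)) {c..b}"
proof -
  define F where "F = (\<lambda>u::real. s / u\<^sup>2 - 2 / u)"
  have above: "((\<lambda>u. max 0 (u - s) * (2 / u ^ 3)) has_integral (F b - F a)) {a..b}"
    if a: "a > 0" "a \<ge> s" "a \<le> b" for a
  proof (rule fundamental_theorem_of_calculus)
    fix u assume u: "u \<in> {a..b}"
    then have "u > 0" "u \<ge> s" using a by auto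
    then have "(F has_field_derivative (max 0 (u - s) * (2 / u ^ 3))) (at u within {a..b})"
      unfolding F_def
      by (auto intro!: derivative_eq_intros simp: field_simps power2_eq_square power3_eq_cube)
    then show "(F has_vector_derivative (max 0 (u - s) * (2 / u ^ 3))) (at u within {a..b})"
      by (simp add: has_real_derivative_iff_has_vector_derivative)
  qed (use a in auto)
  show ?thesis
  proof (cases "s \<le> c")
    case True
    have "F b - F c = tangent_recip c s - 1 / b - (b - s) / b\<^sup>2"
      unfolding F_def tangent_recip_def using assms True
      by (simp add: field_simps power2_eq_square)
    then show ?thesis using above[of c] assms True by simp
  next
    case False
    have "((\<lambda>u. max 0 (u - s) * (2 / u ^ 3)) has_integral 0) {c..s}"
      by (rule has_integral_is_0) auto
    from has_integral_combine[OF _ _ this above[of s]]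
    have "((\<lambda>u. max 0 (u - s) * (2 / u ^ 3)) has_integral (0 + (F b - F s))) {c..b}"
      using assms False by auto
    moreover have "F b - F s = tangent_recip c s - 1 / b - (b - s) / b\<^sup>2"
      unfolding F_def tangent_recip_def using assms False
      by (simp add: field_simps power2_eq_square)
    ultimately show ?thesis by simp
  qed
qed

lemma sum_mangoldt_max_le:
  assumes "u \<ge> ln 1024" "u \<le> ln (real y)" "y > 0"
  shows "(\<Sum>n=1..y. mangoldt n / real n * max 0 (u - ln (real n)))
         \<le> u\<^sup>2 / 2 - (19/33) * u + 64 / 100"
proof -
  have eu: "exp u \<ge> 1024" "exp u \<le> real y"
    using assms ln_ge_iff[of 1024 u] ln_ge_iff[of "real y" u] by (auto simp: ln_le_cancel_iff)
  define N where "N = nat \<lfloor>exp u\<rfloor>"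
  have N: "N \<le> y" using eu unfolding N_def by (simp add: nat_le_iff floor_le_iff)
  have "(\<Sum>n=1..y. mangoldt n / real n * max 0 (u - ln (real n))) =
      (\<Sum>n=1..N. mangoldt n / real n * ln (exp u / real n))"
  proof (rule sum.mono_neutral_cong_right)
    show "\<forall>n\<in>{1..y} - {1..N}. mangoldt n / real n * max 0 (u - ln (real n)) = 0"
    proof
      fix n assume "n \<in> {1..y} - {1..N}"
      then have "real n > exp u" "n > 0" unfolding N_def by (auto simp: not_le; linarith)+
      then have "ln (real n) > u" using ln_less_cancel_iff[of "exp u" "real n"] by simp
      then show "mangoldt n / real n * max 0 (u - ln (real n)) = 0" by simp
    qed
    fix n assume n: "n \<in> {1..N}"
    then have "real n \<le> exp u" unfolding N_def by (auto simp: le_nat_iff le_floor_iff)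
    then have "ln (real n) \<le> u" using n ln_le_cancel_iff[of "real n" "exp u"] by simp
    then show "mangoldt n / real n * max 0 (u - ln (real n)) =
        mangoldt n / real n * ln (exp u / real n)"
      using n by (simp add: ln_div)
  qed (use N in auto)
  also have "\<dots> \<le> (ln (exp u))\<^sup>2 / 2 - (19/33) * ln (exp u) + 64 / 100"
    unfolding N_def by (rule sum_mangoldt_ln_le_quadratic) (use eu in auto)
  finally show ?thesis by simp
qed

text \<open>
  Integrate the bound \<open>u^2 / 2 - (19/33) u + 64/100\<close> for the sums with weight \<open>max 0 (u - ln n)\<close>
  against \<open>2 / u^3\<close>; its leading term produces \<open>ln b - ln c\<close>.
\<close>

lemma sum_mangoldt_tangent_recip_le:
  fixes y :: nat
  assumes "y \<ge> 1024"
  defines "b \<equiv> ln (real y)" and "c \<equiv> ln (1024 :: real)"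
  shows "(\<Sum>n=1..y. mangoldt n / real n * (tangent_recip c (ln (real n)) - 1 / b))
         \<le> 1/2 + ln (b / c) - 2 * (19/33) / c + (19/33) / b + (64/100) / c\<^sup>2"
proof -
  define w where "w n = mangoldt n / real n" for n :: nat
  have w: "w n \<ge> 0" for n unfolding w_def by (simp add: mangoldt_nonneg)
  have c: "c > 0" "c \<le> b" unfolding c_def b_def using assms(1) by auto
  have lnle: "ln (real n) \<le> b" if "n \<in> {1..y}" for n
    using that unfolding b_def by auto
  define G :: "real \<Rightarrow> real" where "G = (\<lambda>u. ln u + 2 * (19/33) / u - (64/100) / u\<^sup>2)"
  have I1: "((\<lambda>u. \<Sum>n=1..y. w n * (max 0 (u - ln (real n)) * (2 / u ^ 3))) has_integral
      (\<Sum>n=1..y. w n * (tangent_recip c (ln (real n)) - 1 / b - (b - ln (real n)) / b\<^sup>2))) {c..b}"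
    using c lnle
    by (intro has_integral_sum has_integral_mult_right tangent_recip_integral) auto
  have I2: "((\<lambda>u. (u\<^sup>2 / 2 - (19/33) * u + 64/100) * (2 / u ^ 3)) has_integral (G b - G c)) {c..b}"
  proof (rule fundamental_theorem_of_calculus)
    fix u assume "u \<in> {c..b}"
    then have "u > 0" using c by auto
    then have "(G has_field_derivative ((u\<^sup>2 / 2 - (19/33) * u + 64/100) * (2 / u ^ 3)))
        (at u within {c..b})"
      unfolding G_def
      by (auto intro!: derivative_eq_intros simp: field_simps power2_eq_square power3_eq_cube)
    then show "(G has_vector_derivative ((u\<^sup>2 / 2 - (19/33) * u + 64/100) * (2 / u ^ 3)))
        (at u within {c..b})"
      by (simp add: has_real_derivative_iff_has_vector_derivative)
  qed (use c in auto)
  have "(\<Sum>n=1..y. w n * (tangent_recip c (ln (real n)) - 1 / b - (b - ln (real n)) / b\<^sup>2))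
      \<le> G b - G c"
  proof (rule has_integral_le[OF I1 I2])
    fix u assume u: "u \<in> {c..b}"
    then have "(\<Sum>n=1..y. w n * max 0 (u - ln (real n))) \<le> u\<^sup>2 / 2 - (19/33) * u + 64 / 100"
      unfolding w_def by (intro sum_mangoldt_max_le) (use assms(1) in \<open>auto simp: c_def b_def\<close>)
    then have "(\<Sum>n=1..y. w n * max 0 (u - ln (real n))) * (2 / u ^ 3)
        \<le> (u\<^sup>2 / 2 - (19/33) * u + 64 / 100) * (2 / u ^ 3)"
      using u c by (intro mult_right_mono) auto
    then show "(\<Sum>n=1..y. w n * (max 0 (u - ln (real n)) * (2 / u ^ 3)))
        \<le> (u\<^sup>2 / 2 - (19/33) * u + 64 / 100) * (2 / u ^ 3)"
      by (simp only: sum_distrib_right mult.assoc)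
  qed
  moreover have "(\<Sum>n=1..y. w n * (b - ln (real n))) / b\<^sup>2
      \<le> (b\<^sup>2 / 2 - (19/33) * b + 64 / 100) / b\<^sup>2"
  proof (intro divide_right_mono)
    have "(\<Sum>n=1..y. w n * (b - ln (real n))) = (\<Sum>n=1..y. w n * max 0 (b - ln (real n)))"
      using lnle by (intro sum.cong) auto
    also have "\<dots> \<le> b\<^sup>2 / 2 - (19/33) * b + 64 / 100"
      unfolding w_def by (intro sum_mangoldt_max_le) (use assms(1) c in \<open>auto simp: c_def b_def\<close>)
    finally show "(\<Sum>n=1..y. w n * (b - ln (real n))) \<le> b\<^sup>2 / 2 - (19/33) * b + 64 / 100" .
  qed auto
  moreover have "(\<Sum>n=1..y. w n * (tangent_recip c (ln (real n)) - 1 / b)) =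
      (\<Sum>n=1..y. w n * (tangent_recip c (ln (real n)) - 1 / b - (b - ln (real n)) / b\<^sup>2))
      + (\<Sum>n=1..y. w n * (b - ln (real n))) / b\<^sup>2"
    unfolding sum_divide_distrib sum.distrib [symmetric]
    by (intro sum.cong) (auto simp: algebra_simps)
  moreover have "(b\<^sup>2 / 2 - (19/33) * b + 64 / 100) / b\<^sup>2 + (G b - G c) =
      1/2 + ln (b / c) - 2 * (19/33) / c + (19/33) / b + (64/100) / c\<^sup>2"
  proof -
    have "ln (b / c) = ln b - ln c" using c by (subst ln_div) auto
    moreover have "(b\<^sup>2 / 2 - (19/33) * b + 64 / 100) / b\<^sup>2 = 1/2 - (19/33) / b + (64/100) / b\<^sup>2"
      using c by (simp add: field_simps power2_eq_square)
    ultimately show ?thesis unfolding G_def by simp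
  qed
  ultimately show ?thesis unfolding w_def by linarith
qed

text \<open>
  The weight \<open>1 - n / y\<close> is at most \<open>n / y\<close> times the integral part of \<open>y / n\<close>, and with these
  larger weights the sum is \<open>ln (y!) / y\<close>.
\<close>

lemma sum_mangoldt_linear_cutoff_le:
  fixes y :: nat
  assumes "y \<ge> 1"
  shows "(\<Sum>n=1..y. mangoldt n / real n * (1 - real n / real y))
          \<le> ln (real y) - 1 + (ln (real y) + 1) / real y"
proof -
  have "(\<Sum>n=1..y. mangoldt n / real n * (1 - real n / real y))
      \<le> (\<Sum>n=1..y. mangoldt n * real (y div n) / real y)"
  proof (intro sum_mono)
    fix n assume n: "n \<in> {1..y}"
    have "real y / real n \<le> real (y div n) + 1"
      using real_of_int_div3[of "int y" "int n"] by (simp flip: of_nat_div)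
    then have "(real y / real n - 1) / real y \<le> real (y div n) / real y"
      by (intro divide_right_mono) auto
    moreover have "(1 - real n / real y) / real n = (real y / real n - 1) / real y"
      using n by (simp add: field_simps)
    ultimately have "(1 - real n / real y) / real n \<le> real (y div n) / real y"
      by simp
    from mult_left_mono[OF this mangoldt_nonneg[of n]]
    show "mangoldt n / real n * (1 - real n / real y) \<le> mangoldt n * real (y div n) / real y"
      by simp
  qed
  also have "\<dots> = ln (fact y) / real y"
    unfolding ln_fact_eq_sum_mangoldt by (simp add: sum_divide_distrib)
  also have "\<dots> \<le> (real y * ln (real y) - real y + ln (real y) + 1) / real y"
    using ln_fact_le[OF assms] by (intro divide_right_mono) auto
  also have "\<dots> = ln (real y) - 1 + (ln (real y) + 1) / real y"
    using assms by (simp add: field_simps)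
  finally show ?thesis .
qed

lemma sum_mangoldt_kernel_le:
  fixes y :: nat
  assumes "y \<ge> 1024"
  defines "b \<equiv> ln (real y)" and "c \<equiv> ln (1024 :: real)"
  shows "(\<Sum>n=1..y. mangoldt n / real n * (tangent_recip c (ln (real n)) - real n / (real y * b)))
         \<le> 3/2 + ln (b / c) - (38/33) / c - (14/33) / b + (64/100) / c\<^sup>2 + (b + 1) / (real y * b)"
proof -
  have b: "b > 0" using assms(1) unfolding b_def by auto
  have "(\<Sum>n=1..y. mangoldt n / real n * (tangent_recip c (ln (real n)) - real n / (real y * b))) =
     (\<Sum>n=1..y. mangoldt n / real n * (tangent_recip c (ln (real n)) - 1 / b)) +
     (\<Sum>n=1..y. mangoldt n / real n * (1 - real n / real y)) / b"
    unfolding sum_divide_distrib sum.distrib [symmetric]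
  proof (intro sum.cong refl)
    fix n assume "n \<in> {1..y}"
    have "(1 - real n / real y) / b = 1 / b - real n / (real y * b)"
      by (simp add: diff_divide_distrib)
    then show "mangoldt n / real n * (tangent_recip c (ln (real n)) - real n / (real y * b)) =
        mangoldt n / real n * (tangent_recip c (ln (real n)) - 1 / b)
        + mangoldt n / real n * (1 - real n / real y) / b"
      by (simp only: times_divide_eq_right [symmetric] distrib_left [symmetric]) simp
  qed
  moreover have "(\<Sum>n=1..y. mangoldt n / real n * (1 - real n / real y)) / b
      \<le> (b - 1 + (b + 1) / real y) / b"
    using sum_mangoldt_linear_cutoff_le[of y] assms(1) b
    by (intro divide_right_mono) (auto simp: b_def)
  moreover have "(b - 1 + (b + 1) / real y) / b = 1 - 1 / b + (b + 1) / (real y * b)"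
    using b assms(1) by (simp add: field_simps)
  moreover have "(19/33) / b - 1 / b = - (14/33) / b" using b by (simp add: field_simps)
  moreover have "2 * (19/33) / c = (38/33) / c" by simp
  ultimately show ?thesis
    using sum_mangoldt_tangent_recip_le[OF assms(1)] unfolding b_def[symmetric] c_def[symmetric]
    by linarith
qed

lemma recip_minus_tangent_recip:
  assumes "0 < s" "0 < c"
  shows "1 / s - tangent_recip c s = (if s \<le> c then (1 - s / c)\<^sup>2 / s else 0)"
  using assms by (simp add: tangent_recip_def field_simps power2_eq_square)

lemma tangent_recip_ge:
  assumes "0 < c" "c \<le> b" "s \<le> b"
  shows "tangent_recip c s \<ge> 1 / b"
proof (cases "s \<le> c")
  case True
  have "s / c\<^sup>2 \<le> c / c\<^sup>2" using True assms by (intro divide_right_mono) auto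
  then have "tangent_recip c s \<ge> 1 / c"
    using True assms by (simp add: tangent_recip_def power2_eq_square)
  moreover have "1 / c \<ge> 1 / b" using assms by (simp add: field_simps)
  ultimately show ?thesis by linarith
next
  case False
  then show ?thesis using assms by (simp add: tangent_recip_def field_simps)
qed

text \<open>
  The kernel is nonnegative up to \<open>y\<close>, so the sum over all prime powers dominates the sum over the primes in
  \<open>P\<close> together with any further set \<open>E\<close> of numbers that are not prime.  The quadratic sum accounts for
  the gap between \<open>1 / ln p\<close> and the tangent line, and beyond \<open>y\<close> a prime is worth no more than its share
  \<open>ln p / (y b)\<close> of the product.
\<close>

lemma sum_recip_primes_le_kernel:
  fixes P E :: "nat set" and y :: nat
  assumes P: "finite P" "\<And>p. p \<in> P \<Longrightarrow> prime p"
    and y: "y \<ge> 1024"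
    and E: "E \<subseteq> {1..y}" "\<And>q. q \<in> E \<Longrightarrow> \<not> prime q"
  defines "b \<equiv> ln (real y)" and "c \<equiv> ln (1024 :: real)"
  defines "g \<equiv> \<lambda>n. mangoldt n / real n * (tangent_recip c (ln (real n)) - real n / (real y * b))"
  shows "(\<Sum>p\<in>P. 1 / real p) \<le> (\<Sum>n=1..y. g n) - (\<Sum>q\<in>E. g q)
      + (\<Sum>p | prime p \<and> p \<le> 1024. (1 - ln (real p) / c)\<^sup>2 / real p)
      + ln (\<Prod>p\<in>P. real p) / (real y * b)"
proof -
  have c: "c > 0" "c \<le> b" unfolding c_def b_def using y by auto
  have b: "b > 0" using c by linarith
  have g_nonneg: "g n \<ge> 0" if "n \<in> {1..y}" for n
  proof -
    have "tangent_recip c (ln (real n)) \<ge> 1 / b"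
      using that c by (intro tangent_recip_ge) (auto simp: b_def)
    moreover have "real n / (real y * b) \<le> 1 / b"
      using that b by (simp add: field_simps)
    ultimately show ?thesis
      unfolding g_def by (intro mult_nonneg_nonneg) (auto simp: mangoldt_nonneg)
  qed
  define q where "q p = (if p \<le> 1024 then (1 - ln (real p) / c)\<^sup>2 / real p else 0)" for p :: nat
  have term_eq: "1 / real p - ln (real p) / (real y * b) = g p + q p"
    if "prime p" for p
  proof -
    have p: "p > 1" using prime_gt_1_nat[OF that] .
    have le_iff: "ln (real p) \<le> c \<longleftrightarrow> p \<le> 1024"
      unfolding c_def using p by simp
    have "1 / real p - ln (real p) / (real y * b) = ln (real p) / real p * (1 / ln (real p) - real p / (real y * b))"
      using p by (simp add: field_simps)
    also have "1 / ln (real p) = tangent_recip c (ln (real p)) +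
       (if ln (real p) \<le> c then (1 - ln (real p) / c)\<^sup>2 / ln (real p) else 0)"
      using recip_minus_tangent_recip[of "ln (real p)" c] p c by simp
    also have "ln (real p) / real p * (\<dots> - real p / (real y * b)) = g p + q p"
      unfolding g_def q_def le_iff using that p by (simp add: algebra_simps)
    finally show ?thesis .
  qed
  have term_neg: "1 / real p - ln (real p) / (real y * b) \<le> 0" if "p > y" for p
  proof -
    have "b \<le> ln (real p)" unfolding b_def using that y by simp
    then have "real y * b \<le> real p * ln (real p)"
      using that b by (intro mult_mono) auto
    then show ?thesis using that b y by (simp add: field_simps)
  qed
  have q_nonneg: "q p \<ge> 0" for p unfolding q_def by simp
  define R where "R = {p. prime p \<and> p \<le> y}"
  have R: "finite R" "R \<subseteq> {1..y}" "R \<inter> E = {}"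
    unfolding R_def using E prime_gt_0_nat by (auto intro: finite_subset[of _ "{..y}"] simp: Suc_le_eq)
  have "(\<Sum>p\<in>P. 1 / real p) = (\<Sum>p\<in>P. 1 / real p - ln (real p) / (real y * b))
      + (\<Sum>p\<in>P. ln (real p)) / (real y * b)"
    by (simp add: sum_subtractf sum_divide_distrib)
  also have "(\<Sum>p\<in>P. ln (real p)) = ln (\<Prod>p\<in>P. real p)"
    using P prime_gt_0_nat by (subst ln_prod) auto
  also have "(\<Sum>p\<in>P. 1 / real p - ln (real p) / (real y * b)) \<le>
      (\<Sum>p\<in>P \<inter> R. g p + q p)"
  proof -
    have "(\<Sum>p\<in>P. 1 / real p - ln (real p) / (real y * b)) =
      (\<Sum>p\<in>P \<inter> R. 1 / real p - ln (real p) / (real y * b)) +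
      (\<Sum>p\<in>P - R. 1 / real p - ln (real p) / (real y * b))"
      using P(1) by (subst sum.Int_Diff[of P _ R]) auto
    also have "(\<Sum>p\<in>P - R. 1 / real p - ln (real p) / (real y * b)) \<le> 0"
      using P term_neg by (intro sum_nonpos) (auto simp: R_def not_le)
    also have "(\<Sum>p\<in>P \<inter> R. 1 / real p - ln (real p) / (real y * b)) = (\<Sum>p\<in>P \<inter> R. g p + q p)"
      using P term_eq by (intro sum.cong) auto
    finally show ?thesis by simp
  qed
  also have "(\<Sum>p\<in>P \<inter> R. g p + q p) \<le> (\<Sum>p\<in>R. g p + q p)"
    using R g_nonneg q_nonneg by (intro sum_mono2) auto
  also have "\<dots> = (\<Sum>p\<in>R. g p) + (\<Sum>p\<in>R. q p)" by (rule sum.distrib)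
  also have "(\<Sum>p\<in>R. q p) = (\<Sum>p | prime p \<and> p \<le> 1024. (1 - ln (real p) / c)\<^sup>2 / real p)"
    using y R by (intro sum.mono_neutral_cong_right) (auto simp: R_def q_def)
  also have "(\<Sum>p\<in>R. g p) + (\<Sum>p\<in>E. g p) = (\<Sum>p\<in>R \<union> E. g p)"
    using R E finite_subset[OF E(1)] by (subst sum.union_disjoint) auto
  then have "(\<Sum>p\<in>R. g p) = (\<Sum>p\<in>R \<union> E. g p) - (\<Sum>p\<in>E. g p)" by simp
  also have "(\<Sum>p\<in>R \<union> E. g p) \<le> (\<Sum>n=1..y. g n)"
    using R E g_nonneg by (intro sum_mono2) auto
  finally show ?thesis by simp
qed

section \<open>Primes up to 1024\<close>

text \<open>
  Entries \<open>(p, a, b)\<close> with \<open>2 ^ a \<le> p ^ b\<close>, so that \<open>a / b\<close> is a lower approximation of the binary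
  logarithm of \<open>p\<close>.  For each prime \<open>p\<close>, the denominator \<open>b\<close> is the one that gives the best approximation
  below a bound that shrinks as \<open>p\<close> grows.
\<close>

definition prime_log_table :: "(nat \<times> nat \<times> nat) list" where
  "prime_log_table = [
     (2,1,1), (3,19,12), (5,65,28), (7,87,31), (11,83,24), (13,37,10), (17,94,23), (19,174,41),
     (23,104,23), (29,34,7), (31,104,21), (37,26,5), (41,16,3), (43,65,12), (47,61,11),
     (53,63,11), (59,47,8), (61,71,12), (67,6,1), (71,43,7), (73,68,11), (79,63,10), (83,51,8),
     (89,71,11), (97,79,12), (101,73,11), (103,20,3), (107,74,11), (109,27,4), (113,75,11),
     (127,83,12), (131,7,1), (137,78,11), (139,64,9), (149,36,5), (151,65,9), (157,51,7),
     (163,22,3), (167,59,8), (173,52,7), (179,82,11), (181,82,11), (191,53,7), (193,91,12),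
     (197,38,5), (199,84,11), (211,54,7), (223,39,5), (227,86,11), (229,47,6), (233,55,7),
     (239,79,10), (241,87,11), (251,95,12), (257,8,1), (263,8,1), (269,8,1), (271,8,1),
     (277,73,9), (281,65,8), (283,57,7), (293,90,11), (307,33,4), (311,33,4), (313,33,4),
     (317,33,4), (331,25,3), (337,25,3), (347,42,5), (349,42,5), (353,42,5), (359,42,5),
     (367,17,2), (373,17,2), (379,17,2), (383,17,2), (389,43,5), (397,43,5), (401,43,5),
     (409,26,3), (419,26,3), (421,26,3), (431,35,4), (433,35,4), (439,35,4), (443,35,4),
     (449,44,5), (457,53,6), (461,53,6), (463,53,6), (467,53,6), (479,53,6), (487,53,6),
     (491,53,6), (499,53,6), (503,53,6), (509,53,6), (521,9,1), (523,9,1), (541,9,1), (547,9,1),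
     (557,9,1), (563,9,1), (569,9,1), (571,9,1), (577,55,6), (587,55,6), (593,46,5), (599,46,5),
     (601,46,5), (607,46,5), (613,37,4), (617,37,4), (619,37,4), (631,37,4), (641,37,4),
     (643,37,4), (647,28,3), (653,28,3), (659,28,3), (661,28,3), (673,28,3), (677,47,5),
     (683,47,5), (691,47,5), (701,47,5), (709,47,5), (719,47,5), (727,19,2), (733,19,2),
     (739,19,2), (743,19,2), (751,19,2), (757,19,2), (761,19,2), (769,19,2), (773,19,2),
     (787,48,5), (797,48,5), (809,48,5), (811,48,5), (821,29,3), (823,29,3), (827,29,3),
     (829,29,3), (839,29,3), (853,29,3), (857,29,3), (859,29,3), (863,39,4), (877,39,4),
     (881,39,4), (883,39,4), (887,39,4), (907,49,5), (911,49,5), (919,59,6), (929,59,6),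
     (937,59,6), (941,59,6), (947,59,6), (953,59,6), (967,59,6), (971,59,6), (977,59,6),
     (983,59,6), (991,59,6), (997,59,6), (1009,59,6), (1013,59,6), (1019,59,6), (1021,59,6)]"

text \<open>
  Entries \<open>(p, k, a, b)\<close> for the proper prime powers \<open>p ^ k \<le> 1024\<close>, with \<open>a / b\<close> as above.
\<close>

definition prime_power_log_table :: "(nat \<times> nat \<times> nat \<times> nat) list" where
  "prime_power_log_table = [
     (2,2,1,1), (2,3,1,1), (2,4,1,1), (2,5,1,1), (2,6,1,1), (2,7,1,1), (2,8,1,1), (2,9,1,1),
     (2,10,1,1), (3,2,19,12), (3,3,19,12), (3,4,19,12), (3,5,19,12), (3,6,19,12), (5,2,65,28),
     (5,3,65,28), (5,4,65,28), (7,2,87,31), (7,3,87,31), (11,2,83,24), (13,2,37,10),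
     (17,2,94,23), (19,2,174,41), (23,2,104,23), (29,2,34,7), (31,2,104,21)]"

lemma prime_log_table_correct:
  "list_all (\<lambda>(p, a, b). 0 < p \<and> 0 < b \<and> 2 ^ a \<le> p ^ b \<and> a \<le> 10 * b) prime_log_table"
  by (simp add: prime_log_table_def)

text \<open>
  The summands are the integers just above \<open>10^8 * (1 - a / (10 b))^2 / p\<close>.  Rounding each term keeps
  the arithmetic small; exact fractions would have the product of all the primes as denominator.
\<close>

lemma prime_log_table_sum:
  "(\<Sum>(p, a, b)\<leftarrow>prime_log_table. (10 * b - a)\<^sup>2 * 1000000 div (b\<^sup>2 * p) + 1) \<le> 103030000"
  by (simp add: prime_log_table_def)

lemma prime_power_log_table_correct:
  "list_all (\<lambda>(p, k, a, b). (p, a, b) \<in> set prime_log_table \<and> p ^ k \<le> 1024 \<and> k * a \<le> 10 * b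
     \<and> k \<ge> 2 \<and> p \<in> {2,3,5,7,11,13,17,19,23,29,31})
   prime_power_log_table"
  by (simp add: prime_log_table_def prime_power_log_table_def)

text \<open>
  The summands are the integral parts of \<open>10^8 * r * (2 - k r) / p^k\<close> for \<open>r = a / (10 b)\<close>.
\<close>

lemma prime_power_log_table_sum:
  "(\<Sum>(p, k, a, b)\<leftarrow>prime_power_log_table. a * (20 * b - k * a) * 1000000 div (b\<^sup>2 * p ^ k)) \<ge> 16500000"
  by (simp add: prime_power_log_table_def)

lemma prime_power_log_table_distinct:
  "distinct (map (\<lambda>(p, k, a, b). p ^ k) prime_power_log_table)"
  by (simp add: prime_power_log_table_def)

text \<open>
  Trial division by the primes up to \<open>31\<close> suffices, as \<open>1024 < 37^2\<close>.  The computation is done with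
  integers, whose binary numerals evaluate much faster than successor terms.
\<close>

lemma sieve_up_to_1024:
  "filter (\<lambda>n::int. \<not> list_ex (\<lambda>d. n mod d = 0 \<and> d < n) [2, 3, 5, 7, 11, 13, 17, 19, 23, 29, 31])
     [2..1024] = [
     2, 3, 5, 7, 11, 13, 17, 19, 23, 29, 31, 37, 41, 43, 47, 53, 59, 61, 67, 71, 73, 79, 83, 89,
     97, 101, 103, 107, 109, 113, 127, 131, 137, 139, 149, 151, 157, 163, 167, 173, 179, 181,
     191, 193, 197, 199, 211, 223, 227, 229, 233, 239, 241, 251, 257, 263, 269, 271, 277, 281,
     283, 293, 307, 311, 313, 317, 331, 337, 347, 349, 353, 359, 367, 373, 379, 383, 389, 397,
     401, 409, 419, 421, 431, 433, 439, 443, 449, 457, 461, 463, 467, 479, 487, 491, 499, 503,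
     509, 521, 523, 541, 547, 557, 563, 569, 571, 577, 587, 593, 599, 601, 607, 613, 617, 619,
     631, 641, 643, 647, 653, 659, 661, 673, 677, 683, 691, 701, 709, 719, 727, 733, 739, 743,
     751, 757, 761, 769, 773, 787, 797, 809, 811, 821, 823, 827, 829, 839, 853, 857, 859, 863,
     877, 881, 883, 887, 907, 911, 919, 929, 937, 941, 947, 953, 967, 971, 977, 983, 991, 997,
     1009, 1013, 1019, 1021]"
  by code_simp

lemma prime_log_table_complete:
  assumes "prime p" "p \<le> 1024"
  shows "p \<in> fst ` set prime_log_table"
proof -
  have *: "\<not> (int p mod d = 0 \<and> d < int p)" if "d \<ge> 2" for d
  proof
    assume "int p mod d = 0 \<and> d < int p"
    then have "nat d dvd p" "nat d < p" using that by (auto simp: mod_eq_0_iff_dvd nat_dvd_iff)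
    then show False using assms(1) that by (auto simp: prime_nat_iff)
  qed
  have "\<not> list_ex (\<lambda>d. int p mod d = 0 \<and> d < int p)
      [2, 3, 5, 7, 11, 13, 17, 19, 23, 29, 31]"
  proof
    assume "list_ex (\<lambda>d. int p mod d = 0 \<and> d < int p) [2, 3, 5, 7, 11, 13, 17, 19, 23, 29, 31]"
    then obtain d where d: "d \<in> set [2, 3, 5, 7, 11, 13, 17, 19, 23, 29, 31]"
        "int p mod d = 0 \<and> d < int p"
      unfolding list_ex_iff by (rule bexE)
    from d(1) have "d \<ge> 2" by auto
    from *[OF this] d(2) show False by contradiction
  qed
  moreover have "int p \<in> {2..1024}" using prime_ge_2_nat[OF assms(1)] assms(2) by simp
  ultimately have "int p \<in> set (filter (\<lambda>n::int. \<not> list_ex (\<lambda>d. n mod d = 0 \<and> d < n)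
      [2, 3, 5, 7, 11, 13, 17, 19, 23, 29, 31]) [2..1024])"
    unfolding set_filter set_upto mem_Collect_eq by (rule conjI[rotated])
  also have "filter (\<lambda>n::int. \<not> list_ex (\<lambda>d. n mod d = 0 \<and> d < n)
      [2, 3, 5, 7, 11, 13, 17, 19, 23, 29, 31]) [2..1024] = map (\<lambda>(p, a, b). int p) prime_log_table"
    unfolding sieve_up_to_1024 by (simp add: prime_log_table_def)
  finally show ?thesis by force
qed

section \<open>Explicit upper bounds for sums of reciprocals of primes\<close>

lemma sum_set_le_sum_list:
  fixes f :: "'a \<Rightarrow> real"
  assumes "\<And>x. x \<in> set xs \<Longrightarrow> f x \<ge> 0"
  shows "sum f (set xs) \<le> sum_list (map f xs)"
  using assms
proof (induction xs)
  case (Cons x xs)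
  have "sum f (set (x # xs)) \<le> f x + sum f (set xs)"
    using Cons.prems by (cases "x \<in> set xs") (auto simp: insert_absorb)
  then show ?case using Cons by (simp add: order_trans)
qed auto

lemma sum_list_affine:
  "(\<Sum>x\<leftarrow>xs. real (w x) / d - e) = real (\<Sum>x\<leftarrow>xs. w x) / d - real (length xs) * e"
  by (induction xs) (auto simp: add_divide_distrib algebra_simps)

lemma real_div_le_div_plus_1: "real u / real v \<le> real (u div v) + 1"
  using real_of_int_div3[of "int u" "int v"] by (simp flip: of_nat_div)

lemma ln_1024: "ln (1024 :: real) = 10 * ln 2"
  using ln_realpow[of 2 10] by simp

lemma log_table_ln_ge:
  assumes "(p, a, b) \<in> set prime_log_table"
  shows "real a / (10 * real b) \<le> ln (real p) / ln 1024" "p > 0" "b > 0" "a \<le> 10 * b"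
proof -
  have *: "0 < p \<and> 0 < b \<and> 2 ^ a \<le> p ^ b \<and> a \<le> 10 * b"
    using prime_log_table_correct assms unfolding list_all_iff by blast
  then show "p > 0" "b > 0" "a \<le> 10 * b" by auto
  have "real (2 ^ a) \<le> real (p ^ b)" using * by (simp only: of_nat_le_iff)
  then have "ln (2 ^ a) \<le> ln (real p ^ b)" using * by (subst ln_le_cancel_iff) auto
  then have "real a * ln 2 \<le> real b * ln (real p)" using * by (simp add: ln_realpow)
  then show "real a / (10 * real b) \<le> ln (real p) / ln 1024"
    using * by (simp add: ln_1024 field_simps)
qed

text \<open>
  The summand decreases in \<open>ln p\<close> as long as \<open>p \<le> 1024\<close>, so the lower approximations of the
  logarithms from the table give an upper bound.
\<close>

lemma sum_small_primes_le:
  "(\<Sum>p | prime p \<and> p \<le> 1024. (1 - ln (real p) / ln 1024)\<^sup>2 / real p) \<le> 10303 / 10000"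
proof -
  define F where "F = (\<lambda>p::nat. (1 - ln (real p) / ln 1024)\<^sup>2 / real p)"
  define w :: "nat \<times> nat \<times> nat \<Rightarrow> nat" where
    "w = (\<lambda>(p, a, b). (10 * b - a)\<^sup>2 * 1000000 div (b\<^sup>2 * p) + 1)"
  have f_le: "F (fst x) \<le> real (w x) / 100000000" if "x \<in> set (filter (\<lambda>x. fst x \<le> 1024) prime_log_table)" for x
  proof -
    obtain p a b where x: "x = (p, a, b)" by (cases x)
    note t = log_table_ln_ge[of p a b] that[unfolded x]
    have t': "real a / (10 * real b) \<le> ln (real p) / ln 1024" "p > 0" "b > 0" "a \<le> 10 * b" "p \<le> 1024"
      using t by auto
    have "ln (real p) / ln 1024 \<le> 1" using t' by simp
    then have "(1 - ln (real p) / ln 1024)\<^sup>2 \<le> (1 - real a / (10 * real b))\<^sup>2"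
      using t' by (intro power_mono) auto
    then have "F p \<le> (1 - real a / (10 * real b))\<^sup>2 / real p"
      unfolding F_def by (intro divide_right_mono) auto
    also have "1 - real a / (10 * real b) = real (10 * b - a) / (10 * real b)"
      using t' by (simp add: field_simps of_nat_diff)
    also have "(real (10 * b - a) / (10 * real b))\<^sup>2 / real p =
       real ((10 * b - a)\<^sup>2 * 1000000) / real (b\<^sup>2 * p) / 100000000"
      using t' by (simp add: field_simps power2_eq_square)
    also have "\<dots> \<le> real (w x) / 100000000"
    proof (intro divide_right_mono)
      show "real ((10 * b - a)\<^sup>2 * 1000000) / real (b\<^sup>2 * p) \<le> real (w x)"
        using real_div_le_div_plus_1[of "(10 * b - a)\<^sup>2 * 1000000" "b\<^sup>2 * p"]
        unfolding w_def x by simp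
    qed auto
    finally show ?thesis unfolding x by simp
  qed
  have "(\<Sum>p | prime p \<and> p \<le> 1024. F p) \<le> sum F (fst ` set (filter (\<lambda>x. fst x \<le> 1024) prime_log_table))"
    using prime_log_table_complete by (intro sum_mono2) (auto simp: F_def)
  also have "\<dots> \<le> sum (F \<circ> fst) (set (filter (\<lambda>x. fst x \<le> 1024) prime_log_table))"
    by (intro sum_image_le) (auto simp: F_def)
  also have "\<dots> \<le> sum (\<lambda>x. real (w x) / 100000000) (set (filter (\<lambda>x. fst x \<le> 1024) prime_log_table))"
    using f_le by (intro sum_mono) simp
  also have "\<dots> \<le> sum (\<lambda>x. real (w x) / 100000000) (set prime_log_table)"
    by (intro sum_mono2) auto
  also have "\<dots> \<le> (\<Sum>x\<leftarrow>prime_log_table. real (w x) / 100000000)"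
    by (intro sum_set_le_sum_list) auto
  also have "\<dots> = real (\<Sum>x\<leftarrow>prime_log_table. w x) / 100000000"
    using sum_list_affine[of w 100000000 0 prime_log_table] by simp
  also have "\<dots> \<le> real 103030000 / 100000000"
    using prime_log_table_sum unfolding w_def by (intro divide_right_mono) (simp only: of_nat_le_iff, simp)
  finally show ?thesis unfolding F_def by simp
qed

definition small_prime_powers :: "nat set" where
  "small_prime_powers = (\<lambda>(p, k, a, b). p ^ k) ` set prime_power_log_table"

text \<open>
  With \<open>s = ln p / ln 1024\<close> the main part of the summand at \<open>q = p^k\<close> is \<open>s (2 - k s) / q\<close>.
  This increases in \<open>s\<close> while \<open>k s \<le> 1\<close>, so again lower approximations of the logarithms suffice.
\<close>

lemma sum_small_prime_powers_ge:
  assumes "d > 0"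
  shows "(\<Sum>q\<in>small_prime_powers. mangoldt q / real q *
           (tangent_recip (ln 1024) (ln (real q)) - real q / d)) \<ge> 165 / 1000 - 100 / d"
proof -
  define c where "c = ln (1024::real)"
  have c: "c > 0" unfolding c_def by simp
  define g where "g q = mangoldt q / real q * (tangent_recip c (ln (real q)) - real q / d)" for q :: nat
  define w :: "nat \<times> nat \<times> nat \<times> nat \<Rightarrow> nat" where
    "w = (\<lambda>(p, k, a, b). a * (20 * b - k * a) * 1000000 div (b\<^sup>2 * p ^ k))"
  define qq :: "nat \<times> nat \<times> nat \<times> nat \<Rightarrow> nat" where "qq = (\<lambda>(p, k, a, b). p ^ k)"
  have g_ge: "g (qq x) \<ge> real (w x) / 100000000 - (7/2) / d" if "x \<in> set prime_power_log_table" for x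
  proof -
    obtain p k a b where x: "x = (p, k, a, b)" by (cases x)
    have t: "(p, a, b) \<in> set prime_log_table" "p ^ k \<le> 1024" "k * a \<le> 10 * b" "k \<ge> 2"
       "p \<in> {2,3,5,7,11,13,17,19,23,29,31}"
      using prime_power_log_table_correct that unfolding list_all_iff x by blast+
    note t' = log_table_ln_ge[OF t(1)]
    have p: "prime p" using t(5) by (elim insertE) (simp_all, simp?)
    define s where "s = ln (real p) / c"
    define r where "r = real a / (10 * real b)"
    have rs: "r \<le> s" "r \<ge> 0" using t'(1) unfolding r_def s_def c_def by auto
    have lnq: "ln (real (p ^ k)) = real k * ln (real p)" using t'(2) by (simp add: ln_realpow)
    have "ln (real (p ^ k)) \<le> c"
      unfolding c_def using t(2) t'(2) by (subst ln_le_cancel_iff) (auto simp flip: of_nat_power)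
    then have ks: "real k * s \<le> 1" using c unfolding lnq s_def by (simp add: field_simps)
    have "g (p ^ k) = ln (real p) / real (p ^ k) * (2 / c - real k * ln (real p) / c\<^sup>2 - real (p ^ k) / d)"
      using p t(4) \<open>ln (real (p ^ k)) \<le> c\<close> unfolding g_def tangent_recip_def lnq
      by (simp add: mangoldt_primepow)
    also have "\<dots> = s * (2 - real k * s) / real (p ^ k) - ln (real p) / d"
      using c t'(2) assms unfolding s_def by (simp add: field_simps power2_eq_square)
    finally have g_eq: "g (p ^ k) = s * (2 - real k * s) / real (p ^ k) - ln (real p) / d" .
    have "s * (2 - real k * s) - r * (2 - real k * r) = (s - r) * (2 - real k * s - real k * r)"
      by (simp add: algebra_simps)
    also have "\<dots> \<ge> 0"
    proof (intro mult_nonneg_nonneg)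
      have "real k * r \<le> real k * s" using rs by (intro mult_left_mono) auto
      then show "0 \<le> 2 - real k * s - real k * r" using ks by linarith
    qed (use rs in auto)
    finally have "r * (2 - real k * r) / real (p ^ k) \<le> s * (2 - real k * s) / real (p ^ k)"
      by (intro divide_right_mono) auto
    moreover have "real (w x) / 100000000 \<le> r * (2 - real k * r) / real (p ^ k)"
    proof -
      have "real (w x) \<le> real (a * (20 * b - k * a) * 1000000) / real (b\<^sup>2 * p ^ k)"
        unfolding w_def x prod.case by (rule of_nat_div_le_of_nat)
      also have "\<dots> = r * (2 - real k * r) / real (p ^ k) * 100000000"
      proof -
        have "real (a * (20 * b - k * a) * 1000000) = real a * (20 * real b - real k * real a) * 1000000"
          using t(3) by (simp add: of_nat_diff)
        then show ?thesis
          unfolding r_def using t'(2,3) by (simp only:) (simp add: field_simps power2_eq_square)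
      qed
      finally show ?thesis by (simp add: field_simps)
    qed
    moreover have "ln (real p) / d \<le> (7/2) / d"
    proof (intro divide_right_mono)
      have "ln (real p) \<le> ln 32" using t(5) t'(2) by (subst ln_le_cancel_iff) auto
      also have "\<dots> \<le> 7/2" using ln_realpow[of 2 5] ln_2_bounds by simp
      finally show "ln (real p) \<le> 7/2" .
    qed (use assms in auto)
    ultimately have "real (w x) / 100000000 - (7/2) / d \<le> g (p ^ k)" unfolding g_eq by linarith
    then show ?thesis unfolding qq_def x by simp
  qed
  have "165 / 1000 - 100 / d \<le> (\<Sum>x\<leftarrow>prime_power_log_table. real (w x) / 100000000 - (7/2) / d)"
  proof -
    have "(\<Sum>x\<leftarrow>prime_power_log_table. real (w x) / 100000000 - (7/2) / d) =
      real (\<Sum>x\<leftarrow>prime_power_log_table. w x) / 100000000 - real (length prime_power_log_table) * ((7/2) / d)"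
      by (rule sum_list_affine)
    moreover have "length prime_power_log_table = 26" by (simp add: prime_power_log_table_def)
    moreover have "(\<Sum>x\<leftarrow>prime_power_log_table. w x) \<ge> 16500000"
      using prime_power_log_table_sum unfolding w_def by simp
    then have "real (\<Sum>x\<leftarrow>prime_power_log_table. w x) / 100000000 \<ge> 165 / 1000" by simp
    moreover have "26 * ((7/2) / d) \<le> 100 / d" using assms by (simp add: field_simps)
    ultimately show ?thesis by simp
  qed
  also have "\<dots> \<le> (\<Sum>x\<leftarrow>prime_power_log_table. g (qq x))"
    using g_ge by (intro sum_list_mono) auto
  also have "\<dots> = (\<Sum>q\<leftarrow>map qq prime_power_log_table. g q)" by (simp add: comp_def)
  also have "\<dots> = sum g (set (map qq prime_power_log_table))"
    using prime_power_log_table_distinct unfolding qq_def by (rule sum_list_distinct_conv_sum_set)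
  also have "set (map qq prime_power_log_table) = small_prime_powers"
    unfolding small_prime_powers_def qq_def by simp
  finally show ?thesis unfolding g_def c_def .
qed

lemma small_prime_powers_bounds:
  "small_prime_powers \<subseteq> {1..1024}" "q \<in> small_prime_powers \<Longrightarrow> \<not> prime q"
proof -
  show "small_prime_powers \<subseteq> {1..1024}"
    unfolding small_prime_powers_def prime_power_log_table_def by simp
  assume "q \<in> small_prime_powers"
  then obtain p k a b where q: "q = p ^ k" "(p, k, a, b) \<in> set prime_power_log_table"
    unfolding small_prime_powers_def by auto
  then have "k \<ge> 2" using prime_power_log_table_correct unfolding list_all_iff by blast
  then show "\<not> prime q" unfolding q by (auto simp: prime_power_iff)
qed

lemma sum_recip_primes_le:
  fixes P :: "nat set" and y :: nat
  assumes "finite P" "\<And>p. p \<in> P \<Longrightarrow> prime p" "y \<ge> 1024"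
  defines "b \<equiv> ln (real y)"
  shows "(\<Sum>p\<in>P. 1 / real p) \<le> 3/2 + ln (b / (10 * ln 2)) - (38/33) / (10 * ln 2) - (14/33) / b
     + (64/100) / (10 * ln 2)\<^sup>2 + 10303 / 10000 - 165 / 1000
     + (b + 101 + ln (\<Prod>p\<in>P. real p)) / (real y * b)"
proof -
  have b: "b > 0" using assms(3) unfolding b_def by auto
  then have yb: "real y * b > 0" using assms(3) by simp
  have "small_prime_powers \<subseteq> {1..y}" using small_prime_powers_bounds(1) assms(3) by auto
  note * = sum_recip_primes_le_kernel[OF assms(1-3) this small_prime_powers_bounds(2), folded b_def]
  have "(b + 101 + ln (\<Prod>p\<in>P. real p)) / (real y * b) =
     (b + 1) / (real y * b) + 100 / (real y * b) + ln (\<Prod>p\<in>P. real p) / (real y * b)"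
    by (simp add: add_divide_distrib)
  then show ?thesis
    using * sum_mangoldt_kernel_le[OF assms(3), folded b_def] sum_small_prime_powers_ge[OF yb]
      sum_small_primes_le
    unfolding ln_1024 by linarith
qed

text \<open>
  A power of two as cutoff turns both \<open>b\<close> and \<open>c\<close> into multiples of \<open>ln 2\<close>, so that \<open>ln (b / c)\<close> is the
  logarithm of a rational number.
\<close>

lemma sum_recip_primes_le_two_power:
  fixes P :: "nat set" and e :: nat and l X :: real
  assumes P: "finite P" "\<And>p. p \<in> P \<Longrightarrow> prime p" and e: "e \<ge> 40"
    and l: "ln (real e / 10) \<le> l"
    and X: "ln (\<Prod>p\<in>P. real p) \<le> X" "X \<ge> 0"
  shows "(\<Sum>p\<in>P. 1 / real p) \<le> 22126 / 10000 + l - (14/33) / (6932/10000 * real e)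
     + (1/1000000 + X / (2 ^ e * (6931/10000 * real e)))"
proof -
  define b where "b = real e * ln 2"
  have b: "b = ln (real (2 ^ e))" unfolding b_def by (simp add: ln_realpow)
  have b_bounds: "b \<ge> 6931/10000 * real e" "b \<le> 6932/10000 * real e"
    unfolding b_def using mult_right_mono[OF ln_2_bounds(1), of "real e"]
      mult_right_mono[OF ln_2_bounds(2), of "real e"] by (simp_all add: mult.commute)
  then have b27: "b \<ge> 27" using e by simp
  have y: "(2::nat) ^ e \<ge> 2 ^ 40" using e by (intro power_increasing) auto
  then have y': "(2::real) ^ e \<ge> 2 ^ 40" using e by (intro power_increasing) auto
  have pos: "(2::real) ^ e * b > 0" using b27 by simp
  have "(2::nat) ^ e \<ge> 1024" using y by simp
  from sum_recip_primes_le[OF P this, folded b]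
  have "(\<Sum>p\<in>P. 1 / real p) \<le> 3/2 + ln (b / (10 * ln 2)) - (38/33) / (10 * ln 2) - (14/33) / b
     + (64/100) / (10 * ln 2)\<^sup>2 + 10303 / 10000 - 165 / 1000
     + (b + 101 + ln (\<Prod>p\<in>P. real p)) / (2 ^ e * b)" by simp
  moreover have "ln (b / (10 * ln 2)) \<le> l" using l unfolding b_def by simp
  moreover have "(38/33) / (10 * ln 2) \<ge> (38/33) / (10 * (6932 / 10000 :: real))"
    using ln_2_bounds by (intro divide_left_mono) auto
  then have "(38/33) / (10 * ln 2) \<ge> (16611 / 100000 :: real)" by simp
  moreover have "(64/100) / (10 * ln 2)\<^sup>2 \<le> (64/100) / (10 * (6931 / 10000 :: real))\<^sup>2"
    using ln_2_bounds by (intro divide_left_mono power_mono mult_left_mono) auto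
  then have "(64/100) / (10 * ln 2)\<^sup>2 \<le> (1333 / 100000 :: real)"
    by (simp add: power2_eq_square)
  moreover have "(14/33) / b \<ge> (14/33) / (6932/10000 * real e)"
    using b_bounds b27 e by (intro divide_left_mono) auto
  moreover have "(b + 101 + ln (\<Prod>p\<in>P. real p)) / (2 ^ e * b)
      \<le> 1/1000000 + X / (2 ^ e * (6931/10000 * real e))"
  proof -
    have "(b + 101 + ln (\<Prod>p\<in>P. real p)) / (2 ^ e * b) \<le> (b * 1000 + X) / (2 ^ e * b)"
      using X b27 pos by (intro divide_right_mono) auto
    also have "\<dots> = 1000 / 2 ^ e + X / (2 ^ e * b)"
      using b27 by (simp add: add_divide_distrib)
    also have "1000 / (2::real) ^ e \<le> 1000 / 2 ^ 40" using y' by (intro divide_left_mono) auto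
    also have "1000 / 2 ^ 40 \<le> (1/1000000::real)" by simp
    also have "X / (2 ^ e * b) \<le> X / (2 ^ e * (6931/10000 * real e))"
      using X b_bounds b27 e by (intro divide_left_mono mult_left_mono) auto
    finally show ?thesis by simp
  qed
  ultimately show ?thesis by linarith
qed

lemma ln_4_le: "ln (4 :: real) \<le> 13864 / 10000"
  using ln_realpow[of 2 2] ln_2_bounds by simp

lemma ln_57_10_le: "ln (57 / 10 :: real) \<le> 17415 / 10000"
  using ln_approx_bounds[of "57/10" 8] by (simp add: eval_nat_numeral)

text \<open>
  The bound is optimal for a cutoff near the exponent \<open>X\<close>; here \<open>2^57 = 1.44 * 10^17\<close>.
\<close>

lemma sum_recip_primes_le_huge:
  assumes "finite P" "\<And>p. p \<in> P \<Longrightarrow> prime p" "ln (\<Prod>p\<in>P. real p) \<le> 11514 * 10 ^ 13"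
  shows "(\<Sum>p\<in>P. 1 / real p) \<le> 3964 / 1000"
  using sum_recip_primes_le_two_power[OF assms(1,2), of 57 "17415/10000" "11514 * 10 ^ 13"]
    ln_57_10_le assms(3) by simp

lemma sum_recip_primes_le_large:
  assumes "finite P" "\<And>p. p \<in> P \<Longrightarrow> prime p" "ln (\<Prod>p\<in>P. real p) \<le> 11514 * 10 ^ 8"
  shows "(\<Sum>p\<in>P. 1 / real p) \<le> 3625 / 1000"
  using sum_recip_primes_le_two_power[OF assms(1,2), of 40 "13864/10000" "11514 * 10 ^ 8"]
    ln_4_le assms(3) by simp

section \<open>Power sums modulo primes\<close>

lemma power_sum_blocks:
  assumes "M dvd d"
  shows "[(\<Sum>j<d * q. int j ^ k) = int q * (\<Sum>j<d. int j ^ k)] (mod int M)"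
proof (induction q)
  case (Suc q)
  have "(\<Sum>j<d * Suc q. int j ^ k) = (\<Sum>j<d * q. int j ^ k) + (\<Sum>j<d. int (d * q + j) ^ k)"
    using sum.nat_group[of "\<lambda>j. int j ^ k" d "Suc q"] sum.nat_group[of "\<lambda>j. int j ^ k" d q]
      sum.shift_bounds_nat_ivl[of "\<lambda>j. int j ^ k" 0 "q * d" d]
    by (simp add: mult.commute add.commute atLeast0LessThan)
  also have "[\<dots> = int q * (\<Sum>j<d. int j ^ k) + (\<Sum>j<d. int j ^ k)] (mod int M)"
  proof (intro cong_add[OF Suc] cong_sum cong_pow)
    fix j
    have "int M dvd int (d * q)" using assms by simp
    then show "[int (d * q + j) = int j] (mod int M)" by (simp add: cong_iff_dvd_diff)
  qed
  finally show ?case by (simp add: algebra_simps)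
qed auto

lemma power_sum_prime_eq_minus_1:
  assumes "prime p" "p - 1 dvd k" "k > 0"
  shows "[(\<Sum>j<p. int j ^ k) = -1] (mod int p)"
proof -
  have p: "p > 1" using assms(1) by (rule prime_gt_1_nat)
  have "{..<p} = insert 0 {1..<p}" using p by auto
  then have "(\<Sum>j<p. int j ^ k) = (\<Sum>j=1..<p. int j ^ k)" using assms(3) by simp
  also have "[\<dots> = (\<Sum>j=1..<p. 1)] (mod int p)"
  proof (rule cong_sum)
    fix j assume "j \<in> {1..<p}"
    then have "\<not> p dvd j" by (auto dest: dvd_imp_le)
    then have "[j ^ (p - 1) = 1] (mod p)" by (rule fermat_theorem[OF assms(1)])
    from cong_pow[OF this, of "k div (p - 1)"] have "[j ^ k = 1] (mod p)"
      using assms(2) by (simp flip: power_mult)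
    then show "[int j ^ k = 1] (mod int p)" by (simp flip: cong_int_iff)
  qed
  also have "(\<Sum>j=1..<p. 1) = int p - 1" using p by simp
  also have "[int p - 1 = -1] (mod int p)" by (simp add: cong_iff_dvd_diff)
  finally show ?thesis .
qed

text \<open>
  Multiplication by a primitive root \<open>g\<close> permutes the residues, so the sum is unchanged by the factor
  \<open>g ^ k\<close>, which is not \<open>1\<close>.
\<close>

lemma power_sum_prime_eq_0:
  assumes "prime p" "\<not> p - 1 dvd k" "k > 0"
  shows "[(\<Sum>j<p. int j ^ k) = 0] (mod int p)"
proof -
  obtain g where g: "residue_primroot p g" using prime_primitive_root_exists[OF prime_gt_1_nat[OF assms(1)] assms(1)] by auto
  have p: "p > 0" using prime_gt_0_nat[OF assms(1)] .
  have cop: "coprime p g" using g by (simp add: residue_primroot_def)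
  have "ord p g = p - 1" using g assms(1) by (simp add: residue_primroot_def totient_prime)
  then have "\<not> [g ^ k = 1] (mod p)" using assms(2) by (simp add: ord_divides')
  then have "\<not> [int g ^ k = 1] (mod int p)" by (simp flip: cong_int_iff)
  then have ndvd: "\<not> int p dvd int g ^ k - 1" by (simp add: cong_iff_dvd_diff)
  have inj: "inj_on (\<lambda>j. g * j mod p) {..<p}"
  proof (rule inj_onI)
    fix i j assume ij: "i \<in> {..<p}" "j \<in> {..<p}" "g * i mod p = g * j mod p"
    then have "[i = j] (mod p)"
      using cop by (simp add: unique_euclidean_semiring_class.cong_def[symmetric] cong_mult_lcancel_nat coprime_commute)
    then show "i = j" using ij by (simp add: unique_euclidean_semiring_class.cong_def)
  qed
  have "(\<lambda>j. g * j mod p) ` {..<p} = {..<p}"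
    using inj p by (intro endo_inj_surj) auto
  then have "(\<Sum>j<p. int j ^ k) = (\<Sum>j<p. int (g * j mod p) ^ k)"
    using sum.reindex[OF inj, of "\<lambda>j. int j ^ k"] by simp
  also have "[\<dots> = (\<Sum>j<p. int (g * j) ^ k)] (mod int p)"
    by (intro cong_sum cong_pow) (simp add: zmod_int)
  also have "(\<Sum>j<p. int (g * j) ^ k) = int g ^ k * (\<Sum>j<p. int j ^ k)"
    by (simp add: power_mult_distrib sum_distrib_left)
  finally have "int p dvd (int g ^ k - 1) * (\<Sum>j<p. int j ^ k)"
    by (simp add: cong_iff_dvd_diff algebra_simps dvd_diff_commute)
  then have "int p dvd (\<Sum>j<p. int j ^ k)"
    using ndvd assms(1) by (subst (asm) prime_dvd_mult_iff) auto
  then show ?thesis by (simp add: cong_0_iff)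
qed

lemma power_sum_mod_prime:
  assumes "prime p" "p dvd N" "k > 0"
  shows "[(\<Sum>j<N. int j ^ k) = (if p - 1 dvd k then - int (N div p) else 0)] (mod int p)"
proof -
  have "[(\<Sum>j<p * (N div p). int j ^ k) = int (N div p) * (\<Sum>j<p. int j ^ k)] (mod int p)"
    by (rule power_sum_blocks) auto
  moreover have "[int (N div p) * (\<Sum>j<p. int j ^ k) =
      int (N div p) * (if p - 1 dvd k then -1 else 0)] (mod int p)"
    using power_sum_prime_eq_minus_1[OF assms(1) _ assms(3)] power_sum_prime_eq_0[OF assms(1) _ assms(3)]
    by (intro cong_mult cong_refl) auto
  ultimately have "[(\<Sum>j<p * (N div p). int j ^ k) =
      int (N div p) * (if p - 1 dvd k then -1 else 0)] (mod int p)"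
    by (rule cong_trans)
  then show ?thesis using assms(2) by auto
qed

text \<open>
  A nonzero value rules out the vanishing case of the power sum, and then \<open>x ^ k\<close> is \<open>1\<close> by Fermat's
  theorem.
\<close>

lemma power_sum_eq_nonzero_power:
  assumes p: "prime p" "p dvd N" and k: "k > 0"
    and sum: "[(\<Sum>j<N. int j ^ k) = int (c * x ^ k)] (mod int p)" and "\<not> p dvd c" "\<not> p dvd x"
  shows "p - 1 dvd k" "p dvd N div p + c"
proof -
  have *: "[(if p - 1 dvd k then - int (N div p) else 0) = int (c * x ^ k)] (mod int p)"
    using power_sum_mod_prime[OF p k] sum by (meson cong_sym cong_trans)
  have "\<not> p dvd c * x ^ k"
    using assms(5,6) p(1) by (metis prime_dvd_mult_iff prime_dvd_power)
  then have "\<not> [0 = int (c * x ^ k)] (mod int p)"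
    by (metis cong_0_iff cong_sym of_nat_dvd_iff)
  then show dvd: "p - 1 dvd k" using * by (auto split: if_splits)
  have "[x ^ (p - 1) = 1] (mod p)" by (rule fermat_theorem[OF p(1) assms(6)])
  from cong_pow[OF this, of "k div (p - 1)"] have "[x ^ k = 1] (mod p)"
    using dvd by (simp flip: power_mult)
  then have "[c * x ^ k = c * 1] (mod p)" by (intro cong_mult cong_refl)
  then have "[int (c * x ^ k) = int c] (mod int p)" by (simp only: cong_int_iff mult_1_right)
  then have "[- int (N div p) = int c] (mod int p)" using * dvd by (auto intro: cong_trans)
  then have "int p dvd - int (N div p) - int c" by (simp add: cong_iff_dvd_diff)
  moreover have "- int (N div p) - int c = - int (N div p + c)" by simp
  ultimately show "p dvd N div p + c" by (metis dvd_minus_iff of_nat_dvd_iff)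
qed

text \<open>
  Doubling the range doubles the sum modulo the next power of two: \<open>(d + j) ^ k\<close> and \<open>j ^ k\<close> agree
  modulo \<open>2 d\<close> because \<open>k\<close> is even.
\<close>

lemma power_sum_two_power:
  assumes "even k" "k > 0"
  shows "[(\<Sum>j<2 ^ Suc a * u. int j ^ k) = 2 ^ a * int u] (mod 2 ^ Suc a)"
proof (induction a)
  case 0
  have "[(\<Sum>j<2 * u. int j ^ k) = int u * (\<Sum>j<2. int j ^ k)] (mod int 2)"
    by (rule power_sum_blocks) auto
  moreover have "(\<Sum>j<2. int j ^ k) = 1" using assms(2) by (simp add: numeral_2_eq_2)
  ultimately show ?case by simp
next
  case (Suc a)
  define d where "d = 2 ^ Suc a * u"
  have shift: "[int (d + j) ^ k = int j ^ k] (mod 2 ^ Suc (Suc a))" for j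
  proof -
    have "int (d + j) ^ 2 - int j ^ 2 = 2 ^ Suc (Suc a) * (int u * (int j + 2 ^ a * int u))"
      unfolding d_def by (simp add: power2_eq_square algebra_simps)
    then have "[int (d + j) ^ 2 = int j ^ 2] (mod 2 ^ Suc (Suc a))"
      by (simp only: cong_iff_dvd_diff dvd_triv_left)
    from cong_pow[OF this, of "k div 2"] show ?thesis
      using assms(1) by (simp flip: power_mult)
  qed
  have "(\<Sum>j<2 ^ Suc (Suc a) * u. int j ^ k) = (\<Sum>j<d + d. int j ^ k)"
    by (simp add: d_def algebra_simps)
  also have "\<dots> = (\<Sum>j<d. int j ^ k) + (\<Sum>j<d. int (d + j) ^ k)"
    using sum.nat_group[of "\<lambda>j. int j ^ k" d 2]
      sum.shift_bounds_nat_ivl[of "\<lambda>j. int j ^ k" 0 d d]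
    by (simp add: numeral_2_eq_2 atLeast0LessThan add.commute)
  also have "[\<dots> = (\<Sum>j<d. int j ^ k) + (\<Sum>j<d. int j ^ k)] (mod 2 ^ Suc (Suc a))"
    using shift by (intro cong_add cong_refl cong_sum)
  also have "(\<Sum>j<d. int j ^ k) + (\<Sum>j<d. int j ^ k) = 2 * (\<Sum>j<d. int j ^ k)" by simp
  also have "[\<dots> = 2 * (2 ^ a * int u)] (mod 2 ^ Suc (Suc a))"
  proof -
    have "2 ^ Suc a dvd (\<Sum>j<d. int j ^ k) - 2 ^ a * int u"
      using Suc by (simp add: d_def cong_iff_dvd_diff)
    then have "2 * 2 ^ Suc a dvd 2 * ((\<Sum>j<d. int j ^ k) - 2 ^ a * int u)"
      by (rule mult_dvd_mono[OF dvd_refl])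
    then show ?thesis by (simp add: cong_iff_dvd_diff algebra_simps)
  qed
  finally show ?case by (simp add: mult.assoc)
qed

text \<open>
  If \<open>p^2\<close> divided \<open>n\<close>, then \<open>p\<close> would divide \<open>c\<close>; so \<open>n\<close> is squarefree.  In the sum of the
  \<open>n / q\<close> all terms but the one for \<open>q = p\<close> vanish modulo \<open>p\<close>, so every \<open>p\<close>, and hence \<open>n\<close>, divides
  \<open>e\<close> times this sum plus \<open>c\<close>.
\<close>

lemma weighted_sum_prime_factors:
  fixes n e c :: nat
  assumes "n > 0" "c > 0" "coprime c n"
    and dvd: "\<And>p. prime p \<Longrightarrow> p dvd n \<Longrightarrow> p dvd e * (n div p) + c"
  obtains t :: nat where "e * (\<Sum>p\<in>prime_factors n. n div p) + c = t * n"
    "real e * (\<Sum>p\<in>prime_factors n. 1 / real p) = real t - real c / real n" "t > 0"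
    "(\<Prod>p\<in>prime_factors n. p) = n"
proof -
  have sqf: "squarefree n"
  proof (subst squarefree_factorial_semiring, safe)
    fix p assume p: "prime p" "p\<^sup>2 dvd n"
    then have "p dvd n" by (simp add: power2_eq_square dvd_mult_left)
    then have "p dvd n div p" using p by (metis dvd_div_iff_mult not_prime_0 power2_eq_square)
    then have "p dvd c" using dvd[OF p(1) \<open>p dvd n\<close>] by (simp add: dvd_add_right_iff)
    then show False using \<open>p dvd n\<close> assms(3) p(1) by (meson coprime_common_divisor not_prime_unit)
  qed (use assms in auto)
  define X where "X = e * (\<Sum>p\<in>prime_factors n. n div p) + c"
  have X: "p dvd X" if p: "prime p" "p dvd n" for p
  proof -
    have "p \<in> prime_factors n" using p assms(1) by (simp add: prime_factors_dvd)
    then have "X = (e * (n div p) + c) + e * (\<Sum>q\<in>prime_factors n - {p}. n div q)"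
      unfolding X_def by (subst sum.remove[of _ p]) (auto simp: algebra_simps)
    moreover have "p dvd n div q" if "q \<in> prime_factors n - {p}" for q
    proof -
      have "coprime p q" using that p by (auto simp: primes_coprime in_prime_factors_iff)
      then have "p * q dvd n" using that p by (intro divides_mult) (auto simp: in_prime_factors_iff)
      then show ?thesis using that by (subst dvd_div_iff_mult) (auto simp: in_prime_factors_iff)
    qed
    ultimately show ?thesis using dvd[OF p] by (auto intro!: dvd_add dvd_mult dvd_sum)
  qed
  have "X > 0" using assms(2) by (simp add: X_def)
  have "n dvd X"
  proof (rule multiplicity_le_imp_dvd)
    fix p :: nat assume p: "prime p"
    show "multiplicity p n \<le> multiplicity p X"
    proof (cases "p dvd n")
      case True
      have "multiplicity p n \<le> 1" using sqf assms(1) p by (subst (asm) squarefree_factorial_semiring'') auto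
      also have "1 \<le> multiplicity p X"
        using X[OF p True] \<open>X > 0\<close> p by (intro multiplicity_geI) auto
      finally show ?thesis .
    qed (auto simp: not_dvd_imp_multiplicity_0)
  qed (use assms in auto)
  then obtain t where t: "X = t * n" by (metis dvd_div_mult_self)
  have "real X = real n * (real e * (\<Sum>p\<in>prime_factors n. 1 / real p)) + real c"
  proof -
    have "real (n div p) = real n * (1 / real p)" if "p \<in> prime_factors n" for p
      using that by (simp add: real_of_nat_div in_prime_factors_iff)
    then have "(\<Sum>p\<in>prime_factors n. real (n div p)) = real n * (\<Sum>p\<in>prime_factors n. 1 / real p)"
      unfolding sum_distrib_left by (intro sum.cong) auto
    moreover have "real X = real e * (\<Sum>p\<in>prime_factors n. real (n div p)) + real c"
      by (simp add: X_def)
    ultimately show ?thesis by simp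
  qed
  then have "real e * (\<Sum>p\<in>prime_factors n. 1 / real p) = real t - real c / real n"
    using assms(1) t by (simp add: field_simps)
  moreover have "t > 0" using t \<open>X > 0\<close> by (auto intro: Nat.gr0I)
  moreover have "(\<Prod>p\<in>prime_factors n. p) = n"
  proof -
    have "(\<Prod>p\<in>prime_factors n. p ^ multiplicity p n) = n"
      using prod_prime_factors[of n] assms(1) by simp
    moreover have "multiplicity p n = 1" if "p \<in> prime_factors n" for p
      using that sqf assms(1) by (simp add: squarefree_factorial_semiring')
    ultimately show ?thesis by simp
  qed
  ultimately show ?thesis using t X_def by (intro that[of t]) simp_all
qed

section \<open>The Erdos-Moser equation modulo primes\<close>

text \<open>
  Pair \<open>j\<close> with \<open>2 n - 1 - j\<close>, which has the same even powers modulo \<open>2 n - 1\<close>.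
\<close>

lemma power_sum_mirror:
  assumes "even k" "k > 0" "n > 0"
  shows "[(\<Sum>j<2 * n - 1. int j ^ k) = 2 * (\<Sum>j<n. int j ^ k)] (mod int (2 * n - 1))"
proof -
  have "(\<Sum>j<2 * n - 1. int j ^ k) = (\<Sum>j<n. int j ^ k) + (\<Sum>j=n..<2*n-1. int j ^ k)"
    using assms(3) by (subst sum.union_disjoint[symmetric]) (auto intro!: sum.cong)
  also have "(\<Sum>j=n..<2*n-1. int j ^ k) = (\<Sum>j=1..<n. int (2 * n - 1 - j) ^ k)"
    by (rule sum.reindex_bij_witness[of _ "\<lambda>j. 2*n-1-j" "\<lambda>j. 2*n-1-j"]) auto
  also have "[(\<Sum>j<n. int j ^ k) + \<dots> = (\<Sum>j<n. int j ^ k) + (\<Sum>j=1..<n. int j ^ k)] (mod int (2 * n - 1))"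
  proof (intro cong_add cong_refl cong_sum)
    fix j assume j: "j \<in> {1..<n}"
    have "[int (2 * n - 1 - j) = - int j] (mod int (2 * n - 1))"
      using j by (simp add: cong_iff_dvd_diff of_nat_diff)
    from cong_pow[OF this, of k] show "[int (2 * n - 1 - j) ^ k = int j ^ k] (mod int (2 * n - 1))"
      using assms(1) by simp
  qed
  also have "(\<Sum>j=1..<n. int j ^ k) = (\<Sum>j<n. int j ^ k)"
    using assms(2) by (intro sum.mono_neutral_left) (auto simp: not_le)
  finally show ?thesis by simp
qed

text \<open>
  Gauss's argument: multiply the numbers \<open>1, \<dots>, h\<close> by \<open>-2\<close> and reduce to absolutely least residues.
  This permutes them up to sign, and a minus sign occurs exactly for the \<open>i\<close> with \<open>2 i \<le> h\<close>.
\<close>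

lemma minus_two_power_half:
  assumes p: "prime p" "odd p"
  defines "h \<equiv> (p - 1) div 2"
  shows "[(-2) ^ h = (-1) ^ (h div 2)] (mod int p)"
proof -
  have ph: "p = 2 * h + 1" using p(2) prime_gt_1_nat[OF p(1)] unfolding h_def by presburger
  define f where "f i = (if 2 * i \<le> h then 2 * i else p - 2 * i)" for i
  define s :: "nat \<Rightarrow> int" where "s i = (if 2 * i \<le> h then -1 else 1)" for i
  have inj: "inj_on f {1..h}"
    by (rule inj_onI) (auto simp: f_def ph split: if_splits; presburger)
  have bij: "f ` {1..h} = {1..h}"
    by (rule endo_inj_surj[OF _ _ inj]) (auto simp: f_def ph)
  have "[(\<Prod>i=1..h. (-2) * int i) = (\<Prod>i=1..h. s i * int (f i))] (mod int p)"
  proof (rule cong_prod)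
    fix i assume "i \<in> {1..h}"
    then have "(-2) * int i - s i * int (f i) = (if 2 * i \<le> h then 0 else - int p)"
      by (auto simp: s_def f_def ph of_nat_diff)
    then show "[(-2) * int i = s i * int (f i)] (mod int p)"
      by (simp add: cong_iff_dvd_diff)
  qed
  moreover have "(\<Prod>i=1..h. (-2) * int i) = (-2) ^ h * (\<Prod>i=1..h. int i)"
    by (simp only: prod.distrib) simp
  moreover have "(\<Prod>i=1..h. s i * int (f i)) = (-1) ^ (h div 2) * (\<Prod>i=1..h. int i)"
  proof -
    have "(\<Prod>i=1..h. int (f i)) = (\<Prod>i=1..h. int i)"
      using prod.reindex[OF inj, of int] bij by simp
    moreover have "(\<Prod>i=1..h. s i) = (\<Prod>i=1..h div 2. -1)"
      unfolding s_def by (intro prod.mono_neutral_cong_right) auto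
    ultimately show ?thesis by (simp add: prod.distrib)
  qed
  ultimately have "[(\<Prod>i=1..h. int i) * (-2) ^ h = (\<Prod>i=1..h. int i) * (-1) ^ (h div 2)] (mod int p)"
    by (simp add: mult.commute)
  moreover have "coprime (\<Prod>i=1..h. int i) (int p)"
  proof (rule prod_coprime_left)
    fix i assume "i \<in> {1..h}"
    then have "\<not> p dvd i" unfolding ph by (auto dest: dvd_imp_le)
    then show "coprime (int i) (int p)"
      using p(1) by (metis coprime_commute coprime_int_iff prime_imp_coprime_nat)
  qed
  ultimately show ?thesis by (simp add: cong_mult_lcancel)
qed

text \<open>
  Raising to the power \<open>h = (p - 1) / 2\<close> would give \<open>(-2) ^ h = 1\<close>, but for these residue classes the
  integral part of \<open>h / 2\<close> is odd.
\<close>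

lemma minus_two_not_inverse_square:
  assumes p: "prime p" "[p = 5] (mod 8) \<or> [p = 7] (mod 8)"
  shows "\<not> [(-2) * x\<^sup>2 = 1] (mod int p)"
proof
  assume *: "[(-2) * x\<^sup>2 = 1] (mod int p)"
  define h where "h = (p - 1) div 2"
  have p8: "p mod 8 = 5 \<or> p mod 8 = 7" using p(2) by (simp add: unique_euclidean_semiring_class.cong_def)
  then have odd: "odd p" and h: "odd (h div 2)" and ph: "p - 1 = 2 * h" and "p > 2"
    unfolding h_def by presburger+
  have "\<not> int p dvd x"
  proof
    assume "int p dvd x"
    then have "int p dvd (-2) * x\<^sup>2" by (simp add: power2_eq_square)
    then have "int p dvd 1" using * cong_dvd_iff by blast
    then show False using prime_gt_1_nat[OF p(1)] by simp
  qed
  then have "\<not> p dvd nat \<bar>x\<bar>" by (simp add: int_dvd_int_iff [symmetric])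
  then have "[nat \<bar>x\<bar> ^ (p - 1) = 1] (mod p)" by (rule fermat_theorem[OF p(1)])
  then have "[int (nat \<bar>x\<bar> ^ (p - 1)) = int 1] (mod int p)" by (simp only: cong_int_iff)
  then have x: "[(x\<^sup>2) ^ h = 1] (mod int p)"
    unfolding ph by (simp add: power_mult)
  have "[((-2) * x\<^sup>2) ^ h = 1 ^ h] (mod int p)" by (rule cong_pow[OF *])
  moreover have "[((-2) * x\<^sup>2) ^ h = (-1) ^ (h div 2) * 1] (mod int p)"
    unfolding power_mult_distrib
    by (rule cong_mult[OF minus_two_power_half[OF p(1) odd, folded h_def] x])
  ultimately have "[1 = (-1 :: int)] (mod int p)"
    using h by (metis cong_sym cong_trans mult_1_right power_one uminus_power_if)
  then have "int p dvd 2" by (simp add: cong_iff_dvd_diff)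
  then show False using \<open>p > 2\<close> by (auto dest: zdvd_imp_le)
qed

locale erdos_moser =
  fixes m k :: nat
  assumes m_pos: "m > 0" and k_ge: "k \<ge> 2"
    and power_sum_eq: "(\<Sum>j = 1..m - 1. j ^ k) = m ^ k"
begin

lemma m_gt_3: "m > 3"
proof (rule ccontr)
  assume "\<not> m > 3"
  then consider "m = 1" | "m = 2" | "m = 3" using m_pos by linarith
  then show False
  proof cases
    case 1
    then show False using power_sum_eq by simp
  next
    case 2
    then show False using power_sum_eq power_increasing[OF k_ge, of "2::nat"] by simp
  next
    case 3
    have "3 ^ n > 2 ^ n + (1::nat)" if "n \<ge> 2" for n
      using that by (induction n rule: dec_induct) (auto simp: power2_eq_square)
    from this[OF k_ge] show False using power_sum_eq 3 by (simp add: numeral_2_eq_2)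
  qed
qed

lemma k_pos: "k > 0" using k_ge by simp

lemma power_sum_m: "(\<Sum>j<m. int j ^ k) = int (m ^ k)"
proof -
  have "{..<m} = insert 0 {1..m - 1}" using m_pos by auto
  then have "(\<Sum>j<m. int j ^ k) = int (\<Sum>j=1..m - 1. j ^ k)" using k_pos by simp
  then show ?thesis by (simp only: power_sum_eq)
qed

lemma power_sum_m_plus_1: "(\<Sum>j<m + 1. int j ^ k) = int (2 * m ^ k)"
  using power_sum_m by simp

lemma power_sum_m_plus_2: "(\<Sum>j<m + 2. int j ^ k) = int (2 * m ^ k + (m + 1) ^ k)"
  using power_sum_m by simp

lemma prime_dvd_m_minus_1:
  assumes "prime p" "p dvd m - 1"
  shows "p - 1 dvd k" "p dvd (m - 1) div p + 1"
proof -
  have "(\<Sum>j<m - 1. int j ^ k) = int (m ^ k) - int (m - 1) ^ k"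
    using power_sum_m sum.lessThan_Suc[of "\<lambda>j. int j ^ k" "m - 1"] m_pos by simp
  moreover have "int p dvd int (m - 1) ^ k"
    using assms(2) k_pos by (metis dvd_power_same dvd_trans dvd_power of_nat_dvd_iff)
  ultimately have "[(\<Sum>j<m - 1. int j ^ k) = int (1 * m ^ k)] (mod int p)"
    by (simp add: cong_iff_dvd_diff)
  moreover have "\<not> p dvd m"
  proof
    assume "p dvd m"
    then have "p dvd m - (m - 1)" using assms(2) by (rule dvd_diff_nat)
    then show False using m_pos assms(1) by simp
  qed
  moreover have "\<not> p dvd 1" using prime_gt_1_nat[OF assms(1)] by simp
  ultimately show "p - 1 dvd k" "p dvd (m - 1) div p + 1"
    using power_sum_eq_nonzero_power[OF assms k_pos, of 1 m] by auto
qed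

text \<open>
  \<open>m - 1\<close> has an odd prime factor \<open>p\<close>, because \<open>m > 3\<close> and \<open>4\<close> does not divide \<open>m - 1\<close>; and
  \<open>p - 1\<close> divides \<open>k\<close>.
\<close>

lemma even_k: "even k"
proof -
  define u where "u = (if odd (m - 1) then m - 1 else (m - 1) div 2)"
  have "odd u"
  proof (cases "odd (m - 1)")
    case False
    then have "2 dvd (m - 1) div 2 + 1"
      using prime_dvd_m_minus_1(2)[of 2] two_is_prime_nat by simp
    then show ?thesis using False by (simp add: u_def)
  qed (simp add: u_def)
  moreover have "u > 1 \<or> u = 1" "u dvd m - 1"
    using m_gt_3 by (auto simp: u_def dvd_div_mult_self intro: dvdI[of _ _ 2])
  moreover have "u \<noteq> 1" using m_gt_3 by (auto simp: u_def; presburger)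
  ultimately obtain p where p: "prime p" "p dvd u" using prime_factor_nat by blast
  then have "odd p" using \<open>odd u\<close> by (meson dvd_trans)
  moreover have "p - 1 dvd k" using p \<open>u dvd m - 1\<close> by (intro prime_dvd_m_minus_1(1)) auto
  moreover have "p > 1" using p(1) by (rule prime_gt_1_nat)
  ultimately show ?thesis by (meson dvd_trans odd_even_add even_diff_nat odd_one)
qed

text \<open>
  If \<open>2 ^ (a + 1)\<close> is the exact power of two in an even \<open>m\<close>, the power sum has exactly \<open>a\<close> factors
  two, whereas \<open>m ^ k\<close> has more.
\<close>

lemma odd_m: "odd m"
proof
  assume "even m"
  obtain u where u: "m = 2 ^ multiplicity 2 m * u" "\<not> 2 dvd u"
    using multiplicity_decompose'[of m 2] m_pos by auto
  have "multiplicity 2 m > 0" using \<open>even m\<close> m_pos by (simp add: prime_multiplicity_gt_zero_iff)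
  then obtain a where a: "multiplicity 2 m = Suc a" by (cases "multiplicity 2 m") auto
  have "[int (m ^ k) = 2 ^ a * int u] (mod 2 ^ Suc a)"
    using power_sum_two_power[OF even_k k_pos, of a u] power_sum_m u(1) a by metis
  moreover have "int (2 ^ Suc a) dvd int (m ^ k)"
    unfolding of_nat_dvd_iff using u(1) a k_pos by (metis dvd_power dvd_trans dvd_triv_left)
  ultimately have "2 ^ Suc a dvd 2 ^ a * int u"
    using cong_dvd_iff by fastforce
  then have "2 dvd int u" by (simp add: mult.commute)
  then show False using u(2) by presburger
qed

text \<open>
  The sum over \<open>j \<le> m\<close> is \<open>2 m ^ k\<close>, with exactly one factor two.  By \<open>power_sum_two_power\<close> it has
  one factor less than \<open>m + 1\<close>.
\<close>

lemma m_plus_1_eq: "m + 1 = 4 * ((m + 1) div 4)" "odd ((m + 1) div 4)"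
proof -
  have "[int (2 * m ^ k) = (if 2 - 1 dvd k then - int ((m + 1) div 2) else 0)] (mod int 2)"
    using power_sum_mod_prime[OF two_is_prime_nat _ k_pos, of "m + 1"] odd_m power_sum_m_plus_1
    by simp
  then have "even ((m + 1) div 2)" by (simp add: unique_euclidean_semiring_class.cong_def) presburger
  then show eq: "m + 1 = 4 * ((m + 1) div 4)" using odd_m by presburger
  show "odd ((m + 1) div 4)"
  proof
    assume "even ((m + 1) div 4)"
    then obtain u where "(m + 1) div 4 = 2 * u" by auto
    then have u: "m + 1 = 2 ^ Suc 2 * u" using eq by simp
    have "[int (2 * m ^ k) = 2 ^ 2 * int u] (mod 2 ^ Suc 2)"
      using power_sum_two_power[OF even_k k_pos, of 2 u]
      unfolding u[symmetric] power_sum_m_plus_1 .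
    then have "8 dvd 2 * int (m ^ k) - 4 * int u" by (simp add: cong_iff_dvd_diff)
    then have "even (int (m ^ k))" by presburger
    then show False using odd_m k_pos by simp
  qed
qed

lemma prime_dvd_m_plus_1_div_4:
  assumes "prime p" "p dvd (m + 1) div 4"
  shows "p - 1 dvd k" "p dvd 2 * (((m + 1) div 4) div p) + 1"
proof -
  define n where "n = (m + 1) div 4"
  have odd: "odd p" using assms m_plus_1_eq(2) by (meson dvd_trans)
  then have "\<not> p dvd 2" using assms(1) by (metis primes_dvd_imp_eq two_is_prime_nat even_numeral dvd_refl)
  have dvd: "p dvd m + 1" using assms(2) m_plus_1_eq(1) by (metis dvd_mult)
  have "\<not> p dvd m"
  proof
    assume "p dvd m"
    then have "p dvd (m + 1) - m" using dvd by (intro dvd_diff_nat)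
    then show False using assms(1) by simp
  qed
  note * = power_sum_eq_nonzero_power[OF assms(1) dvd k_pos, of 2 m]
  show "p - 1 dvd k" using * power_sum_m_plus_1 \<open>\<not> p dvd 2\<close> \<open>\<not> p dvd m\<close> by simp
  have "p dvd (m + 1) div p + 2" using * power_sum_m_plus_1 \<open>\<not> p dvd 2\<close> \<open>\<not> p dvd m\<close> by simp
  moreover have "(m + 1) div p + 2 = 2 * (2 * (n div p) + 1)"
  proof -
    have "(4 * n) div p = 4 * (n div p)" using assms(2) unfolding n_def by (simp add: div_mult_swap)
    then show ?thesis using m_plus_1_eq(1) unfolding n_def by simp
  qed
  ultimately show "p dvd 2 * (((m + 1) div 4) div p) + 1"
    using assms(1) \<open>\<not> p dvd 2\<close> unfolding n_def by (metis prime_dvd_mult_iff)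
qed

lemma prime_dvd_2m_minus_1:
  assumes "prime p" "p dvd 2 * m - 1"
  shows "p - 1 dvd k" "p dvd (2 * m - 1) div p + 2"
proof -
  have "odd (2 * m - 1)" using m_pos by simp
  then have "odd p" using assms by (meson dvd_trans)
  then have "\<not> p dvd 2" using assms(1) by (metis primes_dvd_imp_eq two_is_prime_nat even_numeral dvd_refl)
  moreover have "\<not> p dvd m"
  proof
    assume "p dvd m"
    then have "p dvd 2 * m - (2 * m - 1)" using assms(2) by (metis dvd_diff_nat dvd_mult)
    moreover have "2 * m - (2 * m - 1) = 1" using m_pos by linarith
    ultimately show False using prime_gt_1_nat[OF assms(1)] by simp
  qed
  moreover have "[(\<Sum>j<2 * m - 1. int j ^ k) = int (2 * m ^ k)] (mod int p)"
  proof -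
    have "int p dvd int (2 * m - 1)" using assms(2) by (simp only: of_nat_dvd_iff)
    with power_sum_mirror[OF even_k k_pos m_pos, unfolded power_sum_m] show ?thesis
      by (metis cong_dvd_modulus of_nat_mult of_nat_numeral)
  qed
  ultimately show "p - 1 dvd k" "p dvd (2 * m - 1) div p + 2"
    using power_sum_eq_nonzero_power[OF assms k_pos, of 2 m] by auto
qed

lemma prime_dvd_2m_plus_1:
  assumes "prime p" "p dvd 2 * m + 1"
  shows "p - 1 dvd k" "p dvd (2 * m + 1) div p + 4"
proof -
  have "odd (2 * m + 1)" by simp
  then have "odd p" using assms by (meson dvd_trans)
  then have "\<not> p dvd 2" using assms(1) by (metis primes_dvd_imp_eq two_is_prime_nat even_numeral dvd_refl)
  then have "\<not> p dvd 2 * 2" using assms(1) by (metis prime_dvd_mult_iff)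
  moreover have "\<not> p dvd m"
  proof
    assume "p dvd m"
    then have "p dvd 2 * m + 1 - 2 * m" using assms(2) by (intro dvd_diff_nat) auto
    then show False using assms(1) by simp
  qed
  moreover have "[(\<Sum>j<2 * m + 1. int j ^ k) = int (4 * m ^ k)] (mod int p)"
  proof -
    have "2 * (m + 1) - 1 = 2 * m + 1" by simp
    moreover have "m + 1 > 0" by simp
    ultimately have *: "[(\<Sum>j<2 * m + 1. int j ^ k) = 2 * int (2 * m ^ k)] (mod int (2 * m + 1))"
      using power_sum_mirror[OF even_k k_pos, of "m + 1"] power_sum_m_plus_1 by metis
    have "2 * int (2 * m ^ k) = int (4 * m ^ k)" by simp
    moreover have "int p dvd int (2 * m + 1)" using assms(2) by (simp only: of_nat_dvd_iff)
    ultimately show ?thesis using * by (metis cong_dvd_modulus)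
  qed
  ultimately show "p - 1 dvd k" "p dvd (2 * m + 1) div p + 4"
    using power_sum_eq_nonzero_power[OF assms k_pos, of 4 m] by auto
qed

lemma power_sum_m_plus_2_cong:
  assumes "d dvd m + 2"
  shows "[(\<Sum>j<m + 2. int j ^ k) = 2 * 2 ^ k + 1] (mod int d)"
proof -
  have "int d dvd int (m + 2)" using assms by (simp only: of_nat_dvd_iff)
  then have "[int m = - 2] (mod int d)" "[int (m + 1) = - 1] (mod int d)"
    by (simp_all add: cong_iff_dvd_diff add.commute)
  then have "[2 * int m ^ k + int (m + 1) ^ k = 2 * (-2) ^ k + (-1) ^ k] (mod int d)"
    by (intro cong_add cong_mult cong_pow cong_refl)
  then show ?thesis using power_sum_m_plus_2 even_k by simp
qed

text \<open>
  If \<open>p - 1\<close> did not divide \<open>k\<close>, the power sum would vanish modulo \<open>p\<close>, that is \<open>-2 x^2 = 1\<close> for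
  \<open>x = 2 ^ (k / 2)\<close>.
\<close>

lemma prime_dvd_m_plus_2:
  assumes p: "prime p" "p dvd m + 2" and p8: "[p = 5] (mod 8) \<or> [p = 7] (mod 8)"
  shows "p - 1 dvd k" "p dvd (m + 2) div p + 3"
proof -
  have "\<not> p dvd 3"
    using p8 p(1) by (auto simp: unique_euclidean_semiring_class.cong_def dest!: primes_dvd_imp_eq[of p 3])
  have "\<not> p dvd 2"
    using p8 p(1) by (auto simp: unique_euclidean_semiring_class.cong_def dest!: primes_dvd_imp_eq[of p 2])
  show dvd: "p - 1 dvd k"
  proof (rule ccontr)
    assume "\<not> p - 1 dvd k"
    then have "[2 * 2 ^ k + 1 = 0] (mod int p)"
      using power_sum_mod_prime[OF p k_pos] power_sum_m_plus_2_cong[OF p(2)]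
      by (auto intro: cong_trans cong_sym)
    then have "[(-2) * (2 ^ (k div 2))\<^sup>2 = 1] (mod int p)"
      using even_k by (simp add: cong_iff_dvd_diff flip: power_mult) (metis dvd_minus_iff minus_diff_eq diff_minus_eq_add add.commute)
    then show False using minus_two_not_inverse_square[OF p(1) p8] by blast
  qed
  have "[2 ^ (p - 1) = 1] (mod p)" by (rule fermat_theorem[OF p(1) \<open>\<not> p dvd 2\<close>])
  from cong_pow[OF this, of "k div (p - 1)"] have "[2 ^ k = 1] (mod p)"
    using dvd by (simp flip: power_mult)
  then have "[int (2 ^ k) = int 1] (mod int p)" by (simp only: cong_int_iff)
  then have "[2 * 2 ^ k + 1 = 2 * 1 + 1] (mod int p)"
    by (intro cong_add cong_mult cong_refl) simp
  then have "[(\<Sum>j<m + 2. int j ^ k) = int (3 * 1 ^ k)] (mod int p)"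
    using power_sum_m_plus_2_cong[OF p(2)] by (simp add: cong_trans)
  then show "p dvd (m + 2) div p + 3"
    using power_sum_eq_nonzero_power(2)[OF p k_pos, of 3 1] \<open>\<not> p dvd 3\<close> p(1) by auto
qed

text \<open>
  As \<open>6\<close> divides \<open>k\<close>, every \<open>j ^ k\<close> is \<open>0\<close> or \<open>1\<close> modulo \<open>9\<close>, so the power sum over
  \<open>j < 9 n\<close> is \<open>6 n\<close> modulo \<open>9\<close>, while its value \<open>2 ^ (k + 1) + 1\<close> is \<open>3\<close>.
\<close>

lemma nine_dvd_m_plus_2:
  assumes "3 dvd m + 2" "3 dvd k"
  shows "m + 2 = 9 * ((m + 2) div 9)" "((m + 2) div 9) mod 3 = 2"
proof -
  have "k mod 6 = 0" using even_k assms(2) by presburger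
  then obtain l where l: "k = 6 * l" by (auto elim: dvdE)
  then have "l > 0" using k_pos by simp
  have sixth: "[int j ^ 6 = (if 3 dvd j then 0 else 1)] (mod 9)" for j
  proof -
    have "j mod 9 \<in> {0,1,2,3,4,5,6,7,8}" by (simp; presburger)
    moreover have "3 dvd j \<longleftrightarrow> 3 dvd (j mod 9)" by presburger
    ultimately have "(j mod 9) ^ 6 mod 9 = (if 3 dvd j then 0 else 1)" by auto
    then have "[j ^ 6 = (if 3 dvd j then 0 else 1)] (mod 9)"
      by (simp add: unique_euclidean_semiring_class.cong_def power_mod)
    then have "[int (j ^ 6) = int (if 3 dvd j then 0 else 1)] (mod int 9)"
      by (simp only: cong_int_iff)
    then show ?thesis by (simp split: if_splits)
  qed
  have pow: "[int j ^ k = (if 3 dvd j then 0 else 1)] (mod 9)" for j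
    using cong_pow[OF sixth[of j], of l] \<open>l > 0\<close> l by (simp add: power_mult power_0_left split: if_splits)
  have two: "[2 ^ k = (1::int)] (mod 9)" using pow[of 2] by simp
  then have "[2 * 2 ^ k + 1 = 2 * 1 + (1::int)] (mod 9)"
    by (intro cong_add cong_mult cong_refl)
  then have rhs: "[2 * 2 ^ k + 1 = (3::int)] (mod 9)" by simp
  then have "[2 * 2 ^ k + 1 = (3::int)] (mod 3)" by (rule cong_dvd_modulus) simp
  then have "[(\<Sum>j<m + 2. int j ^ k) = 3] (mod int 3)"
    using power_sum_m_plus_2_cong[OF assms(1)] by (metis cong_trans of_nat_numeral)
  moreover have "[(\<Sum>j<m + 2. int j ^ k) = - int ((m + 2) div 3)] (mod int 3)"
    using power_sum_mod_prime[of 3 "m + 2" k] assms(1) k_pos even_k by simp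
  ultimately have "[- int ((m + 2) div 3) = 3] (mod int 3)" by (metis cong_sym cong_trans)
  then have "3 dvd - int ((m + 2) div 3) - 3" by (simp add: cong_iff_dvd_diff)
  then have "3 dvd (m + 2) div 3" by presburger
  then show eq: "m + 2 = 9 * ((m + 2) div 9)" using assms(1) by presburger
  define n where "n = (m + 2) div 9"
  have "[(\<Sum>j<9 * n. int j ^ k) = int n * (\<Sum>j<9. int j ^ k)] (mod int 9)"
    by (rule power_sum_blocks) auto
  also have "[int n * (\<Sum>j<9. int j ^ k) = int n * (\<Sum>j<9::nat. if 3 dvd j then 0 else 1)] (mod int 9)"
    using pow by (intro cong_mult cong_refl cong_sum) simp
  also have "(\<Sum>j<9::nat. if 3 dvd j then 0 else 1) = (6::int)"
    by (simp add: lessThan_nat_numeral lessThan_Suc)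
  finally have "[(\<Sum>j<m + 2. int j ^ k) = int n * 6] (mod 9)"
    using eq by (simp only: n_def) simp
  moreover have "[(\<Sum>j<m + 2. int j ^ k) = 3] (mod 9)"
    using cong_trans[OF power_sum_m_plus_2_cong[of 9], of 3] rhs eq by (metis dvd_triv_left of_nat_numeral)
  ultimately have "[int n * 6 = 3] (mod 9)" by (metis cong_sym cong_trans)
  then have "9 dvd int n * 6 - 3" by (simp add: cong_iff_dvd_diff)
  then have "n mod 3 = 2" by presburger
  then show "((m + 2) div 9) mod 3 = 2" by (simp add: n_def)
qed

lemma prime_dvd_m_plus_2_div_9:
  assumes "3 dvd m + 2" "3 dvd k" and p: "prime p" "p dvd (m + 2) div 9"
    and p8: "[p = 5] (mod 8) \<or> [p = 7] (mod 8)"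
  shows "p dvd 3 * (((m + 2) div 9) div p) + 1"
proof -
  define n where "n = (m + 2) div 9"
  note eq = nine_dvd_m_plus_2(1)[OF assms(1,2)]
  have "p dvd m + 2" using p(2) eq by (metis dvd_mult)
  then have "p dvd (m + 2) div p + 3" using prime_dvd_m_plus_2(2)[OF p(1) _ p8] by blast
  moreover have "(m + 2) div p + 3 = 3 * (3 * (n div p) + 1)"
  proof -
    have "(9 * n) div p = 9 * (n div p)" using p(2) unfolding n_def by (simp add: div_mult_swap)
    then show ?thesis using eq unfolding n_def by simp
  qed
  moreover have "\<not> p dvd 3"
    using p8 p(1) by (auto simp: unique_euclidean_semiring_class.cong_def dest!: primes_dvd_imp_eq[of p 3])
  ultimately show ?thesis using p(1) unfolding n_def by (metis prime_dvd_mult_iff)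
qed

end

section \<open>The size of a solution\<close>

abbreviation recip_sum :: "nat set \<Rightarrow> real" where
  "recip_sum X \<equiv> (\<Sum>p\<in>X. 1 / real p)"

lemma prod_subset_le:
  fixes X Y :: "nat set"
  assumes "finite Y" "X \<subseteq> Y" "\<And>p. p \<in> Y \<Longrightarrow> p \<ge> 1"
  shows "\<Prod>X \<le> \<Prod>Y"
proof (rule dvd_imp_le)
  show "\<Prod>X dvd \<Prod>Y" using assms by (intro prod_dvd_prod_subset)
  show "\<Prod>Y > 0" using assms(3) by (intro prod_pos) (auto simp: Suc_le_eq)
qed

text \<open>
  A crude bound that excludes small \<open>m\<close>, for which the error terms \<open>O(1 / m)\<close> are not negligible: at
  most \<open>12\<close> primes above \<open>30\<close> fit into the product.
\<close>

lemma sum_recip_primes_le_of_prod_le: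
  assumes P: "finite P" "\<And>p. p \<in> P \<Longrightarrow> prime p" and prod: "(\<Prod>p\<in>P. p) \<le> 2 ^ 60"
  shows "recip_sum P \<le> 193 / 100"
proof -
  have "recip_sum (P \<inter> {..<31}) \<le> recip_sum {2,3,5,7,11,13,17,19,23,29}"
  proof (intro sum_mono2)
    show "P \<inter> {..<31} \<subseteq> {2,3,5,7,11,13,17,19,23,29}"
    proof
      fix p assume p: "p \<in> P \<inter> {..<31}"
      then have "p \<ge> 2" "p < 31" using P(2)[of p] prime_ge_2_nat by auto
      moreover have "p = q" if "q dvd p" "prime q" for q
        using that p P(2)[of p] by (metis IntD1 primes_dvd_imp_eq)
      then have "2 dvd p \<longrightarrow> p = 2" "3 dvd p \<longrightarrow> p = 3" "5 dvd p \<longrightarrow> p = 5" by force+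
      ultimately show "p \<in> {2,3,5,7,11,13,17,19,23,29}" by (simp; presburger)
    qed
  qed auto
  also have "\<dots> \<le> 1534 / 1000" by simp
  finally have small: "recip_sum (P \<inter> {..<31}) \<le> 1534 / 1000" .
  have ge1: "p \<ge> 1" if "p \<in> P" for p using P(2)[OF that] prime_ge_1_nat by blast
  have "31 ^ card (P - {..<31}) = (\<Prod>p\<in>P - {..<31}. 31 :: nat)" by simp
  also have "\<dots> \<le> (\<Prod>p\<in>P - {..<31}. p)" by (intro prod_mono) auto
  also have "\<dots> \<le> (\<Prod>p\<in>P. p)"
    using P(1) ge1 by (intro prod_subset_le) auto
  also have "\<dots> < 31 ^ 13" using prod by (rule le_less_trans) simp
  finally have "card (P - {..<31}) < 13" by (subst (asm) power_strict_increasing_iff) auto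
  then have card: "real (card (P - {..<31})) \<le> 12" by simp
  have "recip_sum (P - {..<31}) \<le> (\<Sum>p\<in>P - {..<31}. 1 / 31)"
    by (intro sum_mono) (auto simp: field_simps)
  also have "\<dots> \<le> 12 / 31" using card by simp
  finally have large: "recip_sum (P - {..<31}) \<le> 12 / 31" .
  have "recip_sum P = recip_sum (P \<inter> {..<31}) + recip_sum (P - {..<31})"
    using P(1) by (rule sum.Int_Diff)
  then show ?thesis using small large by simp
qed

lemma dvd_of_linear_combination:
  fixes p a b c u v :: nat
  assumes "p dvd a" "p dvd b" "u * a = v * b + c"
  shows "p dvd c"
  using assms by (metis dvd_add_right_iff dvd_mult)

lemma recip_sum_Un_ge:
  assumes "finite X" "finite Y" "finite Z" "X \<inter> Y \<subseteq> Z"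
  shows "recip_sum (X \<union> Y) \<ge> recip_sum X + recip_sum Y - recip_sum Z"
proof -
  have "recip_sum (X \<inter> Y) \<le> recip_sum Z" using assms by (intro sum_mono2) auto
  then show ?thesis using assms by (subst sum_Un) auto
qed

lemma prod_Un_le:
  fixes X Y :: "nat set"
  assumes "finite X" "finite Y" "\<And>p. p \<in> X \<union> Y \<Longrightarrow> p \<ge> 1"
  shows "\<Prod>(X \<union> Y) \<le> \<Prod>X * \<Prod>Y"
proof -
  have "\<Prod>(X \<union> (Y - X)) = \<Prod>X * \<Prod>(Y - X)"
    using assms by (intro prod.union_disjoint) auto
  moreover have "\<Prod>(Y - X) \<le> \<Prod>Y" using assms by (intro prod_subset_le) auto
  ultimately show ?thesis by (simp add: Un_Diff_cancel)
qed

text \<open>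
  A composite number below \<open>289 = 17^2\<close> has a divisor between \<open>2\<close> and \<open>16\<close>.
\<close>

lemma prime_if_no_small_divisor:
  fixes n :: nat
  assumes "1 < n" "n < 289" "\<forall>d\<in>{2,3,5,7,11,13}. d < n \<longrightarrow> \<not> d dvd n"
  shows "prime n"
proof (rule ccontr)
  assume "\<not> prime n"
  then obtain a where a: "a dvd n" "a \<noteq> 1" "a \<noteq> n"
    using assms(1) by (auto simp: prime_nat_iff)
  then obtain b where n: "n = a * b" by (auto elim: dvdE)
  then have ab: "n = a * b" "a > 1" "b > 1"
    using a assms(1) by (auto intro!: Suc_lessI Nat.gr0I)
  define c where "c = min a b"
  have "c * c \<le> a * b" unfolding c_def by (intro mult_le_mono) auto
  then have "c < 17" using ab(1) assms(2) mult_le_mono[of 17 c 17 c] by linarith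
  moreover have "c \<ge> 2" using ab unfolding c_def by simp
  ultimately have "c \<in> set [2..<17]" by (simp only: set_upt atLeastLessThan_iff)
  then have "\<exists>d\<in>{2,3,5,7,11,13}. d dvd c" by (simp add: upt_conv_Cons; elim disjE; simp)
  then obtain d where d: "d \<in> {2,3,5,7,11,13}" "d dvd c" by blast
  have "c dvd n" "c < n" using ab unfolding c_def by (auto simp: min_def)
  moreover have "d \<le> c" using d(2) ab unfolding c_def by (intro dvd_imp_le) auto
  ultimately show False using d assms(3) by (meson dvd_trans le_less_trans)
qed

text \<open>
  These primes do not occur in the first four numbers if \<open>3\<close> does not divide \<open>k\<close>.  There are just enough
  of them to bring the reciprocal sum, with \<open>1 / 5\<close>, above \<open>2 / 3\<close>.
\<close>

definition primes_one_mod_three :: "nat set" where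
  "primes_one_mod_three =
     {7, 13, 19, 31, 37, 43, 61, 67, 73, 79, 97, 103, 109, 127, 139, 151, 157}"

lemma primes_one_mod_three:
  assumes "p \<in> primes_one_mod_three"
  shows "prime p" "3 dvd p - 1"
proof -
  have "\<forall>p\<in>primes_one_mod_three. 1 < p \<and> p < 289 \<and> (\<forall>d\<in>{2,3,5,7,11,13}. d < p \<longrightarrow> \<not> d dvd p)"
    unfolding primes_one_mod_three_def by simp
  then show "prime p" using assms by (intro prime_if_no_small_divisor) blast+
  have "\<forall>p\<in>primes_one_mod_three. 3 dvd p - 1" unfolding primes_one_mod_three_def by simp
  then show "3 dvd p - 1" using assms by blast
qed

lemma recip_sum_primes_one_mod_three:
  "finite (insert 5 primes_one_mod_three)"
  "recip_sum (insert 5 primes_one_mod_three) \<ge> 2 / 3"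
  "ln (real (\<Prod>(insert 5 primes_one_mod_three))) \<le> 200"
proof -
  show "finite (insert 5 primes_one_mod_three)" "recip_sum (insert 5 primes_one_mod_three) \<ge> 2 / 3"
    unfolding primes_one_mod_three_def by simp_all
  have "real (\<Prod>(insert 5 primes_one_mod_three)) \<le> 2 ^ 152"
       "real (\<Prod>(insert 5 primes_one_mod_three)) > 0"
    unfolding primes_one_mod_three_def by simp_all
  then have "ln (real (\<Prod>(insert 5 primes_one_mod_three))) \<le> ln (2 ^ 152)"
    by (subst ln_le_cancel_iff) simp_all
  also have "\<dots> = real 152 * ln 2" by (rule ln_realpow)
  also have "\<dots> \<le> 200" using ln_2_bounds by simp
  finally show "ln (real (\<Prod>(insert 5 primes_one_mod_three))) \<le> 200" .
qed

context erdos_moser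
begin

lemma m_ge_7: "m \<ge> 7"
proof -
  define q where "q = (m + 1) div 4"
  have q: "m + 1 = 4 * q" "odd q" using m_plus_1_eq unfolding q_def .
  then have "q > 1" using m_gt_3 by linarith
  then show ?thesis using q(1) by linarith
qed

lemma recip_sum_m_minus_1:
  "recip_sum (prime_factors (m - 1)) \<ge> 1 - 1 / (real m - 1)" "\<Prod>(prime_factors (m - 1)) = m - 1"
proof -
  obtain t :: nat where "real 1 * recip_sum (prime_factors (m - 1)) = real t - real 1 / real (m - 1)"
    "t > 0" "\<Prod>(prime_factors (m - 1)) = m - 1"
    by (rule weighted_sum_prime_factors[of "m - 1" 1 1])
       (use m_gt_3 prime_dvd_m_minus_1 in auto)
  then show "recip_sum (prime_factors (m - 1)) \<ge> 1 - 1 / (real m - 1)"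
      "\<Prod>(prime_factors (m - 1)) = m - 1"
    using m_pos by (auto simp: of_nat_diff)
qed

lemma recip_sum_m_plus_1:
  "recip_sum (prime_factors ((m + 1) div 4)) \<ge> 1 / 2 - 2 / (real m + 1)"
  "\<Prod>(prime_factors ((m + 1) div 4)) = (m + 1) div 4"
proof -
  define n where "n = (m + 1) div 4"
  have "m + 1 = 4 * n" using m_plus_1_eq(1) unfolding n_def .
  then have "real (m + 1) = real (4 * n)" by (simp only:)
  then have n: "n > 0" "real n = (real m + 1) / 4" by (auto intro: Nat.gr0I)
  obtain t :: nat where "real 2 * recip_sum (prime_factors n) = real t - real 1 / real n"
    "t > 0" "\<Prod>(prime_factors n) = n"
    by (rule weighted_sum_prime_factors[of n 1 2])
       (use n prime_dvd_m_plus_1_div_4 in \<open>auto simp: n_def\<close>)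
  then show "recip_sum (prime_factors ((m + 1) div 4)) \<ge> 1 / 2 - 2 / (real m + 1)"
      "\<Prod>(prime_factors ((m + 1) div 4)) = (m + 1) div 4"
    using n(2) unfolding n_def[symmetric] by auto
qed

lemma recip_sum_2m_minus_1:
  "recip_sum (prime_factors (2 * m - 1)) \<ge> 1 - 2 / (2 * real m - 1)"
  "\<Prod>(prime_factors (2 * m - 1)) = 2 * m - 1"
proof -
  have "odd (2 * m - 1)" using m_pos by simp
  then have cop: "coprime 2 (2 * m - 1)" by simp
  obtain t :: nat where "real 1 * recip_sum (prime_factors (2 * m - 1)) = real t - real 2 / real (2 * m - 1)"
    "t > 0" "\<Prod>(prime_factors (2 * m - 1)) = 2 * m - 1"
    by (rule weighted_sum_prime_factors[of "2 * m - 1" 2 1])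
       (use m_gt_3 prime_dvd_2m_minus_1 cop in auto)
  then show "recip_sum (prime_factors (2 * m - 1)) \<ge> 1 - 2 / (2 * real m - 1)"
      "\<Prod>(prime_factors (2 * m - 1)) = 2 * m - 1"
    using m_pos by (auto simp: of_nat_diff)
qed

lemma recip_sum_2m_plus_1:
  "recip_sum (prime_factors (2 * m + 1)) \<ge> 1 - 4 / (2 * real m + 1)"
  "\<Prod>(prime_factors (2 * m + 1)) = 2 * m + 1"
proof -
  have "coprime (2 ^ 2) (2 * m + 1)" unfolding coprime_power_left_iff by simp
  then have cop: "coprime 4 (2 * m + 1)" by simp
  obtain t :: nat where "real 1 * recip_sum (prime_factors (2 * m + 1)) = real t - real 4 / real (2 * m + 1)"
    "t > 0" "\<Prod>(prime_factors (2 * m + 1)) = 2 * m + 1"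
    by (rule weighted_sum_prime_factors[of "2 * m + 1" 4 1])
       (use prime_dvd_2m_plus_1 cop in auto)
  then show "recip_sum (prime_factors (2 * m + 1)) \<ge> 1 - 4 / (2 * real m + 1)"
      "\<Prod>(prime_factors (2 * m + 1)) = 2 * m + 1"
    by (auto simp: add.commute)
qed

text \<open>
  The prime \<open>2\<close> is counted with \<open>m - 1\<close>, so \<open>m + 1\<close> enters only through its odd part.
\<close>

definition moser_primes :: "nat set" where
  "moser_primes = prime_factors (m - 1) \<union> prime_factors ((m + 1) div 4)
     \<union> prime_factors (2 * m - 1) \<union> prime_factors (2 * m + 1)"

lemma dvd_of_mem_factors:
  "p \<in> prime_factors (m - 1) \<Longrightarrow> prime p \<and> p dvd m - 1"
  "p \<in> prime_factors ((m + 1) div 4) \<Longrightarrow> prime p \<and> p dvd m + 1 \<and> odd p"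
  "p \<in> prime_factors (2 * m - 1) \<Longrightarrow> prime p \<and> p dvd 2 * m - 1 \<and> odd p"
  "p \<in> prime_factors (2 * m + 1) \<Longrightarrow> prime p \<and> p dvd 2 * m + 1 \<and> odd p"
proof -
  show "prime p \<and> p dvd m - 1" if "p \<in> prime_factors (m - 1)"
    using that by (simp add: in_prime_factors_iff)
  show "prime p \<and> p dvd m + 1 \<and> odd p" if "p \<in> prime_factors ((m + 1) div 4)"
    using that m_plus_1_eq by (metis dvd_mult dvd_trans in_prime_factors_iff)
  have "odd (2 * m - 1)" "odd (2 * m + 1)" using m_pos by auto
  then show "prime p \<and> p dvd 2 * m - 1 \<and> odd p" if "p \<in> prime_factors (2 * m - 1)"
    using that by (metis dvd_trans in_prime_factors_iff)
  show "prime p \<and> p dvd 2 * m + 1 \<and> odd p" if "p \<in> prime_factors (2 * m + 1)"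
    using that \<open>odd (2 * m + 1)\<close> by (metis dvd_trans in_prime_factors_iff)
qed

lemma moser_primes_dvd_k: "p \<in> moser_primes \<Longrightarrow> prime p \<and> p - 1 dvd k"
  unfolding moser_primes_def
  using prime_dvd_m_minus_1(1) prime_dvd_m_plus_1_div_4(1) prime_dvd_2m_minus_1(1) prime_dvd_2m_plus_1(1)
  by (auto simp: in_prime_factors_iff)

lemma common_prime_factor:
  assumes "prime p"
  shows "p dvd m - 1 \<Longrightarrow> p dvd m + 1 \<Longrightarrow> p = 2"
    "p dvd m - 1 \<Longrightarrow> \<not> p dvd 2 * m - 1"
    "p dvd m - 1 \<Longrightarrow> p dvd 2 * m + 1 \<Longrightarrow> p = 3"
    "p dvd m + 1 \<Longrightarrow> p dvd 2 * m - 1 \<Longrightarrow> p = 3"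
    "p dvd m + 1 \<Longrightarrow> \<not> p dvd 2 * m + 1"
    "p dvd 2 * m - 1 \<Longrightarrow> p dvd 2 * m + 1 \<Longrightarrow> p = 2"
    "p dvd m - 1 \<Longrightarrow> p dvd m + 2 \<Longrightarrow> p = 3"
    "p dvd m + 1 \<Longrightarrow> \<not> p dvd m + 2"
    "p dvd 2 * m - 1 \<Longrightarrow> p dvd m + 2 \<Longrightarrow> p = 5"
    "p dvd 2 * m + 1 \<Longrightarrow> p dvd m + 2 \<Longrightarrow> p = 3"
proof -
  have p: "p > 1" using assms by (rule prime_gt_1_nat)
  have eq: "p = q" if "p dvd q" "prime q" for q using that assms by (metis primes_dvd_imp_eq)
  have primes: "prime (2::nat)" "prime (3::nat)" "prime (5::nat)" by simp_all
  note lin = dvd_of_linear_combination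
  show "p dvd m - 1 \<Longrightarrow> p dvd m + 1 \<Longrightarrow> p = 2"
    by (rule eq[OF lin[of p "m + 1" "m - 1" 1 1]]) (use m_pos in auto)
  show "p dvd m - 1 \<Longrightarrow> \<not> p dvd 2 * m - 1"
  proof
    assume "p dvd m - 1" "p dvd 2 * m - 1"
    moreover have "1 * (2 * m - 1) = 2 * (m - 1) + 1" using m_pos by linarith
    ultimately have "p dvd 1" using lin[of p "2 * m - 1" "m - 1" 1 2 1] by blast
    then show False using p by simp
  qed
  show "p dvd m - 1 \<Longrightarrow> p dvd 2 * m + 1 \<Longrightarrow> p = 3"
    by (rule eq[OF lin[of p "2 * m + 1" "m - 1" 1 2]]) (use m_pos in auto)
  show "p dvd m + 1 \<Longrightarrow> p dvd 2 * m - 1 \<Longrightarrow> p = 3"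
    by (rule eq[OF lin[of p "m + 1" "2 * m - 1" 2 1]]) (use m_pos in auto)
  show "p dvd m + 1 \<Longrightarrow> \<not> p dvd 2 * m + 1"
    using lin[of p "m + 1" "2 * m + 1" 2 1 1] p by auto
  show "p dvd 2 * m - 1 \<Longrightarrow> p dvd 2 * m + 1 \<Longrightarrow> p = 2"
    by (rule eq[OF lin[of p "2 * m + 1" "2 * m - 1" 1 1]]) (use m_pos in auto)
  show "p dvd m - 1 \<Longrightarrow> p dvd m + 2 \<Longrightarrow> p = 3"
    by (rule eq[OF lin[of p "m + 2" "m - 1" 1 1]]) (use m_pos in auto)
  show "p dvd m + 1 \<Longrightarrow> \<not> p dvd m + 2"
    using lin[of p "m + 2" "m + 1" 1 1 1] p by auto
  show "p dvd 2 * m - 1 \<Longrightarrow> p dvd m + 2 \<Longrightarrow> p = 5"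
    by (rule eq[OF lin[of p "m + 2" "2 * m - 1" 2 1]]) (use m_pos in auto)
  show "p dvd 2 * m + 1 \<Longrightarrow> p dvd m + 2 \<Longrightarrow> p = 3"
    by (rule eq[OF lin[of p "m + 2" "2 * m + 1" 2 1]]) (use m_pos in auto)
qed

text \<open>
  The four relations contribute \<open>1 + 1/2 + 1 + 1\<close>, and only the prime \<open>3\<close> can divide two of the
  four numbers.
\<close>

lemma recip_sum_moser_primes:
  "recip_sum moser_primes \<ge> 7 / 2 - 1 / 3 - 6 / (real m - 1)"
proof -
  define A where "A = prime_factors (m - 1)"
  define B where "B = prime_factors ((m + 1) div 4)"
  define C where "C = prime_factors (2 * m - 1)"
  define D where "D = prime_factors (2 * m + 1)"
  note defs = A_def B_def C_def D_def
  note mem = dvd_of_mem_factors[folded defs]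
  have fin: "finite A" "finite B" "finite C" "finite D" unfolding defs by auto
  have "\<not> (p \<in> A \<and> p \<in> B)" for p
    using mem(1)[of p] mem(2)[of p] common_prime_factor(1)[of p] by auto
  then have AB: "A \<inter> B = {}" by blast
  have "\<not> (p \<in> C \<and> p \<in> D)" for p
    using mem(3)[of p] mem(4)[of p] common_prime_factor(6)[of p] by auto
  then have CD: "C \<inter> D = {}" by blast
  have "\<not> (p \<in> A \<and> p \<in> C)" "\<not> (p \<in> B \<and> p \<in> D)"
    "p \<in> A \<and> p \<in> D \<longrightarrow> p = 3" "p \<in> B \<and> p \<in> C \<longrightarrow> p = 3" for p
    using mem[of p] common_prime_factor(2-5)[of p] by meson+
  then have "(A \<union> B) \<inter> (C \<union> D) \<subseteq> {3}" by blast
  then have "recip_sum (A \<union> B) + recip_sum (C \<union> D) - recip_sum {3}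
      \<le> recip_sum ((A \<union> B) \<union> (C \<union> D))"
    using fin by (intro recip_sum_Un_ge) auto
  moreover have "recip_sum (A \<union> B) = recip_sum A + recip_sum B"
    using fin AB by (subst sum.union_disjoint) auto
  moreover have "recip_sum (C \<union> D) = recip_sum C + recip_sum D"
    using fin CD by (subst sum.union_disjoint) auto
  moreover have union: "(A \<union> B) \<union> (C \<union> D) = moser_primes"
    unfolding moser_primes_def defs by blast
  moreover have "recip_sum {3} = 1 / 3" by simp
  moreover define x where "x = 1 / (real m - 1)"
  moreover have "2 / (real m + 1) \<le> 2 * x" "2 / (2 * real m - 1) \<le> x" "4 / (2 * real m + 1) \<le> 2 * x"
    unfolding x_def using m_ge_7 by (simp_all add: field_simps)
  moreover have "6 / (real m - 1) = 6 * x" by (simp add: x_def)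
  ultimately show ?thesis
    unfolding union using recip_sum_m_minus_1(1) recip_sum_m_plus_1(1) recip_sum_2m_minus_1(1) recip_sum_2m_plus_1(1)
    unfolding defs[symmetric] by linarith
qed

lemma moser_primes_dvd_m_plus_2:
  assumes "p \<in> moser_primes" "p dvd m + 2" "p > 3"
  shows "p = 5"
proof -
  have p: "prime p" using moser_primes_dvd_k[OF assms(1)] by blast
  from assms(1) consider "p dvd m - 1" | "p dvd m + 1" | "p dvd 2 * m - 1" | "p dvd 2 * m + 1"
    unfolding moser_primes_def using dvd_of_mem_factors by blast
  then show ?thesis
    using common_prime_factor(7-10)[OF p] assms(2,3) by cases auto
qed

lemma finite_moser_primes: "finite moser_primes"
  unfolding moser_primes_def by simp

text \<open>
  The four numbers multiply to \<open>(m^2 - 1) (4 m^2 - 1) / 4\<close>.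
\<close>

lemma prod_moser_primes_Un_le:
  assumes "finite E" "\<And>p. p \<in> E \<Longrightarrow> prime p"
  shows "\<Prod>(moser_primes \<union> E) \<le> m ^ 4 * \<Prod>E"
proof -
  have ge1: "p \<ge> 1" if "prime p" for p :: nat using that by (rule prime_ge_1_nat)
  note fac = in_prime_factors_iff
  have "\<Prod>(moser_primes \<union> E) \<le> \<Prod>moser_primes * \<Prod>E"
    using assms ge1 moser_primes_dvd_k by (intro prod_Un_le) (auto simp: moser_primes_def)
  also have "\<Prod>moser_primes \<le> (m - 1) * ((m + 1) div 4) * (2 * m - 1) * (2 * m + 1)"
  proof -
    define A where "A = prime_factors (m - 1)"
    define B where "B = prime_factors ((m + 1) div 4)"
    define C where "C = prime_factors (2 * m - 1)"
    define D where "D = prime_factors (2 * m + 1)"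
    note defs = A_def B_def C_def D_def
    have fin: "finite A" "finite B" "finite C" "finite D" unfolding defs by auto
    have pos: "p \<ge> 1" if "p \<in> A \<union> B \<union> C \<union> D" for p
      using that ge1 unfolding defs by (auto simp: fac)
    have "\<Prod>(A \<union> B \<union> C \<union> D) \<le> \<Prod>(A \<union> B \<union> C) * \<Prod>D"
      "\<Prod>(A \<union> B \<union> C) \<le> \<Prod>(A \<union> B) * \<Prod>C" "\<Prod>(A \<union> B) \<le> \<Prod>A * \<Prod>B"
      using fin pos by (auto intro!: prod_Un_le)
    then have "\<Prod>(A \<union> B \<union> C \<union> D) \<le> \<Prod>A * \<Prod>B * \<Prod>C * \<Prod>D"
      by (meson le_trans mult_le_mono1)
    then show ?thesis
      unfolding moser_primes_def defs recip_sum_m_minus_1(2) recip_sum_m_plus_1(2)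
        recip_sum_2m_minus_1(2) recip_sum_2m_plus_1(2) .
  qed
  also have "(m - 1) * ((m + 1) div 4) * (2 * m - 1) * (2 * m + 1) \<le> m ^ 4"
  proof -
    define n where "n = (m + 1) div 4"
    have "(m - 1) * (m + 1) \<le> m * m" "(2 * m - 1) * (2 * m + 1) \<le> 4 * (m * m)"
      by (simp_all add: algebra_simps diff_mult_distrib)
    then have "((m - 1) * (m + 1)) * ((2 * m - 1) * (2 * m + 1)) \<le> (m * m) * (4 * (m * m))"
      by (rule mult_le_mono)
    moreover have "m + 1 = 4 * n" using m_plus_1_eq(1) unfolding n_def .
    ultimately have "((m - 1) * (4 * n)) * ((2 * m - 1) * (2 * m + 1)) \<le> (m * m) * (4 * (m * m))"
      by (simp only:)
    moreover have "((m - 1) * (4 * n)) * ((2 * m - 1) * (2 * m + 1)) =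
        4 * ((m - 1) * n * (2 * m - 1) * (2 * m + 1))" by (simp only: ac_simps)
    moreover have "(m * m) * (4 * (m * m)) = 4 * m ^ 4" by (simp add: power4_eq_xxxx)
    ultimately have "4 * ((m - 1) * n * (2 * m - 1) * (2 * m + 1)) \<le> 4 * m ^ 4"
      by (simp only:)
    then show ?thesis unfolding n_def by linarith
  qed
  finally show ?thesis by simp
qed

text \<open>
  Otherwise the four numbers, the second divided by \<open>4\<close>, multiply to at most \<open>2^60\<close>, which is too little
  for their prime factors to have a reciprocal sum above \<open>2\<close>.
\<close>

lemma m_gt_two_power_15: "m > 2 ^ 15"
proof (rule ccontr)
  assume "\<not> m > 2 ^ 15"
  then have "m ^ 4 \<le> (2 ^ 15) ^ 4" by (intro power_mono) auto
  then have "\<Prod>(moser_primes \<union> {}) \<le> 2 ^ 60"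
    using prod_moser_primes_Un_le[of "{}"] by simp
  then have "recip_sum (moser_primes \<union> {}) \<le> 193 / 100"
    using moser_primes_dvd_k by (intro sum_recip_primes_le_of_prod_le) (auto simp: moser_primes_def)
  moreover note recip_sum_moser_primes
  moreover have "6 / (real m - 1) \<le> 1" using m_ge_7 by (simp add: field_simps)
  ultimately show False by simp
qed

lemma ln_m_le:
  assumes "m < 10 ^ e"
  shows "ln (real m) \<le> 23027 / 10000 * real e"
proof -
  have "real m \<le> real (10 ^ e)" using assms by (simp only: of_nat_le_iff)
  then have "ln (real m) \<le> ln (10 ^ e)"
    using m_pos by (subst ln_le_cancel_iff) auto
  also have "\<dots> = (ln 2 + ln 5) * real e"
    using ln_mult[of 2 5] by (simp add: ln_realpow)
  also have "\<dots> \<le> 23027 / 10000 * real e"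
    using ln_2_bounds ln_5_le by (intro mult_right_mono) auto
  finally show ?thesis .
qed

lemma ln_prod_moser_primes_Un_le:
  assumes E: "finite E" "\<And>p. p \<in> E \<Longrightarrow> prime p"
  shows "ln (\<Prod>p\<in>moser_primes \<union> E. real p) \<le> 4 * ln (real m) + ln (real (\<Prod>E))"
proof -
  have pos: "\<Prod>E > 0" "\<Prod>(moser_primes \<union> E) > 0"
    using E(2) moser_primes_dvd_k prime_gt_0_nat by (auto intro!: prod_pos)
  have "real (\<Prod>(moser_primes \<union> E)) \<le> real (m ^ 4 * \<Prod>E)"
    using prod_moser_primes_Un_le[OF E] by (simp only: of_nat_le_iff)
  then have "ln (real (\<Prod>(moser_primes \<union> E))) \<le> ln (real (m ^ 4 * \<Prod>E))"
    using pos m_pos by (subst ln_le_cancel_iff) (auto simp del: of_nat_prod)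
  also have "\<dots> = 4 * ln (real m) + ln (real (\<Prod>E))"
    using pos m_pos by (simp add: ln_mult ln_realpow del: of_nat_prod)
  finally show ?thesis by simp
qed

text \<open>
  The number \<open>89/30\<close> is \<open>7/2 - 1/3 - 1/5\<close>, where \<open>1/5\<close> is the price for a possible common
  prime \<open>5\<close>; the error terms are small because \<open>m > 2^15\<close>.
\<close>

lemma recip_sum_moser_primes_Un_ge:
  assumes "finite E" "E \<inter> moser_primes \<subseteq> {5}"
    and "recip_sum E \<ge> r - 3 / (real m + 2)"
  shows "recip_sum (moser_primes \<union> E) \<ge> 89 / 30 + r - 3 / 10000"
proof -
  have m: "real m - 1 \<ge> 32767" using m_gt_two_power_15 by simp
  have "recip_sum (moser_primes \<union> E) \<ge> recip_sum moser_primes + recip_sum E - recip_sum {5}"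
    using assms(1,2) finite_moser_primes by (intro recip_sum_Un_ge) auto
  moreover have "recip_sum {5} = 1 / 5" by simp
  moreover define x where "x = 1 / (real m - 1)"
  have "x \<le> 1 / 32767" unfolding x_def using m by (intro divide_left_mono) auto
  moreover have "3 / (real m + 2) \<le> 3 / (real m - 1)" using m by (intro divide_left_mono) auto
  then have "3 / (real m + 2) \<le> 3 * x" by (simp add: x_def)
  moreover have "recip_sum moser_primes \<ge> 7 / 2 - 1 / 3 - 6 * x"
    using recip_sum_moser_primes by (simp add: x_def)
  ultimately show ?thesis using assms(3) by linarith
qed

lemma lower_bound_not_three_dvd:
  assumes p8: "\<And>p. \<lbrakk>prime p; p dvd m + 2; p > 3\<rbrakk> \<Longrightarrow> [p = 5] (mod 8) \<or> [p = 7] (mod 8)"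
    and "\<not> 3 dvd m + 2" "e \<le> 10 ^ 16"
  shows "m \<ge> 10 ^ e"
proof (rule ccontr)
  assume "\<not> m \<ge> 10 ^ e"
  then have "m < 10 ^ e" by simp
  define E where "E = prime_factors (m + 2)"
  have E: "prime p" "p dvd m + 2" "p > 3" if "p \<in> E" for p
  proof -
    show p: "prime p" "p dvd m + 2" using that unfolding E_def by (auto simp: in_prime_factors_iff)
    have "odd (m + 2)" using odd_m by simp
    then have "p \<noteq> 2" "p \<noteq> 3" using p(2) assms(2) by auto
    then show "p > 3" using prime_ge_2_nat[OF p(1)] by linarith
  qed
  have cop: "coprime 3 (m + 2)" using assms(2) by (intro prime_imp_coprime) auto
  obtain t :: nat where "real 1 * recip_sum E = real t - real 3 / real (m + 2)"
    "t > 0" and prodE: "\<Prod>E = m + 2"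
    unfolding E_def
    by (rule weighted_sum_prime_factors[of "m + 2" 3 1])
       (use cop E p8 prime_dvd_m_plus_2 in \<open>auto simp: E_def in_prime_factors_iff\<close>)
  then have recE: "recip_sum E \<ge> 1 - 3 / (real m + 2)" by (simp add: add.commute)
  have "E \<inter> moser_primes \<subseteq> {5}"
    using moser_primes_dvd_m_plus_2 E(2,3) by blast
  then have "recip_sum (moser_primes \<union> E) \<ge> 89 / 30 + 1 - 3 / 10000"
    using recE by (intro recip_sum_moser_primes_Un_ge) (auto simp: E_def)
  moreover have "recip_sum (moser_primes \<union> E) \<le> 3964 / 1000"
  proof (rule sum_recip_primes_le_huge)
    have "ln (real (m + 2)) \<le> ln (2 * real m)"
      using m_ge_7 by (subst ln_le_cancel_iff) auto
    also have "\<dots> = ln 2 + ln (real m)" using m_pos by (simp add: ln_mult)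
    finally have "ln (\<Prod>p\<in>moser_primes \<union> E. real p) \<le> 5 * ln (real m) + ln 2"
      using ln_prod_moser_primes_Un_le[of E] E(1) unfolding prodE by (simp add: E_def)
    also have "\<dots> \<le> 5 * (23027 / 10000 * 10 ^ 16) + 1"
    proof -
      have "real e \<le> real (10 ^ 16)" using assms(3) by (simp only: of_nat_le_iff)
      then show ?thesis using ln_m_le[OF \<open>m < 10 ^ e\<close>] ln_2_bounds by simp
    qed
    also have "\<dots> \<le> 11514 * 10 ^ 13" by simp
    finally show "ln (\<Prod>p\<in>moser_primes \<union> E. real p) \<le> 11514 * 10 ^ 13" .
  qed (use E moser_primes_dvd_k in \<open>auto simp: E_def moser_primes_def\<close>)
  ultimately show False by simp
qed

text \<open>
  Any set \<open>E\<close> of primes with reciprocal sum about \<open>2/3\<close> serves the purpose, if it is almost disjoint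
  from the primes of the first four numbers and its product is not much larger than \<open>m\<close>.
\<close>

lemma no_small_m_of_extra_primes:
  assumes "m < 10 ^ e" "e \<le> 10 ^ 11"
    and E: "finite E" "\<And>p. p \<in> E \<Longrightarrow> prime p"
    and inter: "E \<inter> moser_primes \<subseteq> {5}"
    and recE: "recip_sum E \<ge> 2 / 3 - 3 / (real m + 2)"
    and prodE: "ln (real (\<Prod>E)) \<le> ln (real m) + 200"
  shows False
proof -
  have "recip_sum (moser_primes \<union> E) \<ge> 89 / 30 + 2 / 3 - 3 / 10000"
    using E(1) inter recE by (rule recip_sum_moser_primes_Un_ge)
  moreover have "recip_sum (moser_primes \<union> E) \<le> 3625 / 1000"
  proof (rule sum_recip_primes_le_large)
    have "ln (\<Prod>p\<in>moser_primes \<union> E. real p) \<le> 5 * ln (real m) + 200"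
      using ln_prod_moser_primes_Un_le[OF E] prodE by simp
    also have "\<dots> \<le> 5 * (23027 / 10000 * 10 ^ 11) + 200"
    proof -
      have "real e \<le> real (10 ^ 11)" using assms(2) by (simp only: of_nat_le_iff)
      then show ?thesis using ln_m_le[OF assms(1)] by simp
    qed
    also have "\<dots> \<le> 11514 * 10 ^ 8" by simp
    finally show "ln (\<Prod>p\<in>moser_primes \<union> E. real p) \<le> 11514 * 10 ^ 8" .
  qed (use E moser_primes_dvd_k in \<open>auto simp: moser_primes_def\<close>)
  ultimately show False by simp
qed

text \<open>
  If \<open>3\<close> divides \<open>k\<close>, let \<open>n = (m + 2) / 9\<close>.  The relation reads \<open>3 S + 1 = t n\<close>, where \<open>S\<close> is the
  sum of the \<open>n / p\<close>, and modulo \<open>3\<close> it excludes \<open>t = 1\<close>; so the reciprocal sum is about \<open>t / 3 \<ge> 2/3\<close>.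
\<close>

lemma lower_bound_three_dvd:
  assumes p8: "\<And>p. \<lbrakk>prime p; p dvd m + 2; p > 3\<rbrakk> \<Longrightarrow> [p = 5] (mod 8) \<or> [p = 7] (mod 8)"
    and three: "3 dvd m + 2" and e: "e \<le> 10 ^ 11"
  shows "m \<ge> 10 ^ e"
proof (rule ccontr)
  assume "\<not> m \<ge> 10 ^ e"
  then have lt: "m < 10 ^ e" by simp
  show False
  proof (cases "3 dvd k")
    case True
    define n where "n = (m + 2) div 9"
    have n: "m + 2 = 9 * n" "n mod 3 = 2"
      using nine_dvd_m_plus_2[OF three True] unfolding n_def by auto
    define E where "E = prime_factors n"
    have E: "prime p" "p dvd n" "p dvd m + 2" "p > 3" if "p \<in> E" for p
    proof -
      show p: "prime p" "p dvd n" "p dvd m + 2"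
        using that n(1) unfolding E_def by (auto simp: in_prime_factors_iff)
      have "odd (m + 2)" "\<not> 3 dvd n" using odd_m n(2) by auto
      then have "p \<noteq> 2" "p \<noteq> 3" using p by auto
      then show "p > 3" using prime_ge_2_nat[OF p(1)] by linarith
    qed
    have "n > 0" using n(1) by (intro Nat.gr0I) auto
    obtain t :: nat where t: "3 * (\<Sum>p\<in>E. n div p) + 1 = t * n"
        "real 3 * recip_sum E = real t - real 1 / real n" "t > 0" and prodE: "\<Prod>E = n"
      unfolding E_def
      by (rule weighted_sum_prime_factors[of n 1 3])
         (use \<open>n > 0\<close> E p8 prime_dvd_m_plus_2_div_9[OF three True] in
           \<open>auto simp: E_def in_prime_factors_iff n_def\<close>)
    have "(t * n) mod 3 = 1" unfolding t(1)[symmetric] by presburger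
    then have "t \<noteq> 1" using n(2) by auto
    then have "t \<ge> 2" using t(3) by linarith
    then have "real t \<ge> 2" by simp
    moreover have "real n = (real m + 2) / 9"
      using arg_cong[OF n(1), of real] by simp
    then have "real 1 / real n = 3 * (3 / (real m + 2))"
      using \<open>n > 0\<close> by (simp add: field_simps)
    ultimately have recE: "recip_sum E \<ge> 2 / 3 - 3 / (real m + 2)"
      using t(2) by simp
    have inter: "E \<inter> moser_primes \<subseteq> {5}"
      using moser_primes_dvd_m_plus_2 E(3,4) by blast
    have "n \<le> m" using n(1) m_pos by linarith
    then have "ln (real (\<Prod>E)) \<le> ln (real m) + 200"
      unfolding prodE using \<open>n > 0\<close> m_pos by (simp add: add_increasing2)
    then show False
      using no_small_m_of_extra_primes[OF lt e _ _ inter recE] E(1) by (auto simp: E_def)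
  next
    case False
    have inter: "insert 5 primes_one_mod_three \<inter> moser_primes \<subseteq> {5}"
      using primes_one_mod_three(2) moser_primes_dvd_k False by (blast dest: dvd_trans)
    have "recip_sum (insert 5 primes_one_mod_three) \<ge> 2 / 3 - 3 / (real m + 2)"
      by (rule order_trans[OF _ recip_sum_primes_one_mod_three(2)]) simp
    moreover have "ln (real (\<Prod>(insert 5 primes_one_mod_three))) \<le> ln (real m) + 200"
      by (rule order_trans[OF recip_sum_primes_one_mod_three(3)]) (use m_pos in simp)
    moreover have "prime p" if "p \<in> insert 5 primes_one_mod_three" for p
      using that primes_one_mod_three(1) by auto
    ultimately show False
      using no_small_m_of_extra_primes[OF lt e recip_sum_primes_one_mod_three(1) _ inter] by blast
  qed
qed

end

theorem corollary1:
  fixes m k :: nat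
  assumes "m > 0" and "k \<ge> 2"
    and "(\<Sum>j = 1..m - 1. j ^ k) = m ^ k"
    and "\<And>p::nat. \<lbrakk>prime p; p dvd m + 2; p > 3\<rbrakk> \<Longrightarrow> [p = 5] (mod 8) \<or> [p = 7] (mod 8)"
  shows "m \<ge> (if \<not> 3 dvd m + 2 then 10 ^ (10 ^ 16) else 10 ^ (10 ^ 11))"
proof -
  interpret erdos_moser m k using assms(1-3) by unfold_locales
  show ?thesis
  proof (cases "3 dvd m + 2")
    case True
    have "m \<ge> 10 ^ (10 ^ 11)"
      by (rule lower_bound_three_dvd[OF assms(4) True order_refl])
    moreover have "\<not> \<not> 3 dvd m + 2" using True by blast
    ultimately show ?thesis by (rule subst[OF if_not_P[symmetric], rotated])
  next
    case False
    have "m \<ge> 10 ^ (10 ^ 16)"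
      by (rule lower_bound_not_three_dvd[OF assms(4) False order_refl])
    then show ?thesis unfolding if_P[of "\<not> 3 dvd m + 2", OF False] .
  qed
qed

end
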